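(* Let $d\geq 2$, and let $\Phi={}^t(\Phi_1,\dots,\Phi_d)$, $\Omega={}^t(\Omega_1,\dots,\Omega_d)$, with $\Phi_j,\Omega_j\in\mathbb{C}^2$, be unit vectors in $\mathbb{C}^{2d}$. For $(\bm p,\bm q)\in D$ let $U=SC$ be the associated evolution operator on $\ell^2(\mathbb{Z}^d;\mathbb{C}^{2d})$ (see context). Suppose that: (a) $\Phi_j\cdot(\sigma_1\Omega_j)=0$ for all $j\in\{1,\dots,d\}$; (b) $\langle\Phi_l,\sigma_+\Omega_l\rangle_{\mathbb{C}^2}\neq 0$ for some $l\in\{1,\dots,d\}$, which we fix; (c) $a_\Omega(\bm p_0)\neq a_\Phi(\bm p_0)$ for some $\bm p_0\in\{-1,1\}^d$, which we fix. Then there exists $\delta>0$ such that, for every $(\bm p,\bm q)\in D_l$ with $\|(\bm p,\bm q)-(\bm p_0,\bm 0)\|_{\mathbb{R}^d\times\mathbb{C}^d}<\delta$, there exist eigenvalues of $U$. Moreover, for such $(\bm p,\bm q)$: (1) if in addition $a_\Omega(\bm p_0)<a_\Phi(\bm p_0)$, then $g_-(\lambda_\star)$ and $g_+(\lambda_\star)$ are eigenvalues of $U_{\rm I}$ for some $\lambda_\star\in\mathbb{T}_-$; (2) if in addition $a_\Omega(\bm p_0)>a_\Phi(\bm p_0)$, then $g_-(\lambda_\star)$ and $g_+(\lambda_\star)$ are eigenvalues of $U_{\rm I}$ for some $\lambda_\star\in\mathbb{T}_+$.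
   Context: Inner products $\langle\cdot,\cdot\rangle$ are conjugate-linear in the first argument; ${}^*$ on scalars is complex conjugation. For $\Psi={}^t(\psi_1,\psi_2),\Phi={}^t(\phi_1,\phi_2)\in\mathbb{C}^2$, $\Psi\cdot\Phi=\psi_1\phi_1+\psi_2\phi_2$ (bilinear, no conjugation). Matrices: $\sigma_1=\begin{pmatrix}0&1\\1&0\end{pmatrix}$, $\sigma_+=\begin{pmatrix}0&1\\0&0\end{pmatrix}$, $\sigma_3=\begin{pmatrix}1&0\\0&-1\end{pmatrix}$. $D=\{(\bm p,\bm q)\in\mathbb{R}^d\times\mathbb{C}^d: p_j^2+|q_j|^2=1,\ j=1,\dots,d\}$ and $D_l=\{(\bm p,\bm q)\in D: p_lq_l\neq0\}$. $\{\bm e_j\}_{j=1}^d$ is the standard basis of $\mathbb{Z}^d$; $\mathcal{H}=\ell^2(\mathbb{Z}^d;\mathbb{C}^{2d})\simeq\bigoplus_{j=1}^d\ell^2(\mathbb{Z}^d;\mathbb{C}^2)$, $\mathcal{K}=\ell^2(\mathbb{Z}^d)$. Shift: on $\ell^2(\mathbb{Z}^d;\mathbb{C}^2)$, for $\psi={}^t(\psi_1,\psi_2)$, $$(S_j\psi)(\bm x)=\begin{pmatrix}p_j\psi_1(\bm x)+q_j\psi_2(\bm x+\bm e_j)\\ q_j^*\psi_1(\bm x-\bm e_j)-p_j\psi_2(\bm x)\end{pmatrix},$$ and $S=S_1\oplus\cdots\oplus S_d$ on $\mathcal{H}$ (self-adjoint and unitary). Coin: $(C\Psi)(\bm x)=C(\bm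 x)\Psi(\bm x)$, where each $C(\bm x)\in U(2d)$ is self-adjoint with $\dim\ker(C(\bm x)-1)=1$, $C(\bm x)=C_1$ for $\bm x\neq\bm 0$, $C(\bm 0)=C_0$; $\Phi$ is a normalized vector in $\ker(C_1-1)$ and $\Omega$ a normalized vector in $\ker(C_0-1)$. Equivalently $C_1=2|\Phi\rangle\langle\Phi|-1$, $C_0=2|\Omega\rangle\langle\Omega|-1$. Thus $C$ is determined by $\Phi,\Omega$, while $S$ and $U=SC$ depend also on $(\bm p,\bm q)$. Let $\chi(\bm x)=\Phi$ for $\bm x\ne\bm 0$, $\chi(\bm 0)=\Omega$, and $d_\chi:\mathcal{H}\to\mathcal{K}$, $(d_\chi\Psi)(\bm x)=\langle\chi(\bm x),\Psi(\bm x)\rangle_{\mathbb{C}^{2d}}$. Put $\mathcal{D}_\pm=\ker d_\chi\cap\ker(S\pm1)$, $\mathcal{D}_{\rm B}=\mathcal{D}_+\oplus\mathcal{D}_-$, $\mathcal{D}_{\rm I}=\mathcal{D}_{\rm B}^\perp$ (the inherited subspace, which reduces $U$), and $U_{\rm I}=U|_{\mathcal{D}_{\rm I}}$. Further notation: $a_\Omega(\bm p)=\sum_{j=1}^dp_j\langle\Omega_j,\sigma_3\Omega_j\rangle_{\mathbb{C}^2}$, $a_\Phi(\bm p)=\sum_{j=1}^dp_j\langle\Phi_j,\sigma_3\Phi_j\rangle_{\mathbb{C}^2}$, $\lambda(\bm q)=2\sum_{j=1}^d|q_j\langle\Phi_j,\sigma_+\Phi_j\rangle_{\mathbb{C}^2}|$,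 $\mathbb{T}_-=[-1,-\lambda(\bm q)+a_\Phi(\bm p))$, $\mathbb{T}_+=(\lambda(\bm q)+a_\Phi(\bm p),1]$, $g_\pm(\lambda)=e^{\pm i\arccos\lambda}$. *)

theory Defs
  imports "HOL-Analysis.Analysis"
begin

section \<open>Finite-dimensional notions\<close>

type_synonym 'd lattice = "int ^ 'd"
type_synonym 'd spinor = "complex ^ 2 ^ 'd"  \<comment> \<open>\<open>v $ j\<close> is the j-th \<open>\<complex>\<^sup>2\<close>-block of a vector of \<open>\<complex>\<^sup>2\<^sup>d\<close>\<close>

text \<open>The type class inner product of the library is the real one, so the sesquilinear
  inner products (conjugate-linear in the first argument) are introduced here.\<close>

definition cinner2 :: "complex ^ 2 \<Rightarrow> complex ^ 2 \<Rightarrow> complex" where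
  "cinner2 u v = (\<Sum>i\<in>UNIV. cnj (u $ i) * v $ i)"

definition cinner_sp :: "'d::finite spinor \<Rightarrow> 'd spinor \<Rightarrow> complex" where
  "cinner_sp u v = (\<Sum>j\<in>UNIV. cinner2 (u $ j) (v $ j))"

definition scale_sp :: "complex \<Rightarrow> 'd::finite spinor \<Rightarrow> 'd spinor" where
  "scale_sp c v = (\<chi> j. c *s (v $ j))"

definition bdot2 :: "complex ^ 2 \<Rightarrow> complex ^ 2 \<Rightarrow> complex" where
  "bdot2 u v = (\<Sum>i\<in>UNIV. u $ i * v $ i)"

definition sigma1 :: "complex ^ 2 ^ 2" where
  "sigma1 = vector [vector [0, 1], vector [1, 0]]"

definition sigma_plus :: "complex ^ 2 ^ 2" where
  "sigma_plus = vector [vector [0, 1], vector [0, 0]]"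

definition sigma3 :: "complex ^ 2 ^ 2" where
  "sigma3 = vector [vector [1, 0], vector [0, -1]]"


section \<open>Square-summable functions\<close>

text \<open>Elements of \<open>\<ell>\<^sup>2(\<int>\<^sup>d; \<complex>\<^sup>2\<^sup>d)\<close> are represented as plain functions; operators are given by
  their pointwise formulas, and kernels, complements and eigenvectors are
  taken inside \<open>ell2\<close>.\<close>

definition ell2 :: "('a \<Rightarrow> 'b::real_normed_vector) set" where
  "ell2 = {\<Psi>. (\<lambda>x. (norm (\<Psi> x))\<^sup>2) summable_on UNIV}"

type_synonym 'd state = "'d lattice \<Rightarrow> 'd spinor"

definition cinner_ell2 :: "'d::finite state \<Rightarrow> 'd state \<Rightarrow> complex" where
  "cinner_ell2 \<Psi> \<Theta> = (\<Sum>\<^sub>\<infinity>x. cinner_sp (\<Psi> x) (\<Theta> x))"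

definition orth_compl :: "'d::finite state set \<Rightarrow> 'd state set" where
  "orth_compl V = {\<Psi> \<in> ell2. \<forall>\<Theta>\<in>V. cinner_ell2 \<Theta> \<Psi> = 0}"

definition eigenvalue_on :: "'d::finite state set \<Rightarrow> ('d state \<Rightarrow> 'd state) \<Rightarrow> complex \<Rightarrow> bool" where
  \<comment> \<open>\<open>z\<close> is an eigenvalue of the restriction of \<open>T\<close> to the subspace \<open>V\<close>\<close>
  "eigenvalue_on V T z \<longleftrightarrow> (\<exists>\<Psi>\<in>V. \<Psi> \<noteq> (\<lambda>x. 0) \<and> T \<Psi> = (\<lambda>x. scale_sp z (\<Psi> x)))"


section \<open>The split-step quantum walk with one defect\<close>

definition paramD :: "((real ^ 'd::finite) \<times> (complex ^ 'd)) set" where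
  "paramD = {(p, q). \<forall>j. (p $ j)\<^sup>2 + (cmod (q $ j))\<^sup>2 = 1}"

definition paramDl :: "'d::finite \<Rightarrow> ((real ^ 'd) \<times> (complex ^ 'd)) set" where
  "paramDl l = {(p, q) \<in> paramD. complex_of_real (p $ l) * q $ l \<noteq> 0}"

definition shift_comp ::
  "real \<Rightarrow> complex \<Rightarrow> 'd::finite \<Rightarrow> ('d lattice \<Rightarrow> complex ^ 2) \<Rightarrow> 'd lattice \<Rightarrow> complex ^ 2" where
  "shift_comp pj qj j \<psi> x = vector
     [complex_of_real pj * \<psi> x $ 1 + qj * \<psi> (x + axis j 1) $ 2,
      cnj qj * \<psi> (x - axis j 1) $ 1 - complex_of_real pj * \<psi> x $ 2]"

definition shift :: "real ^ 'd::finite \<Rightarrow> complex ^ 'd \<Rightarrow> 'd state \<Rightarrow> 'd state" where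
  "shift p q \<Psi> x = (\<chi> j. shift_comp (p $ j) (q $ j) j (\<lambda>y. \<Psi> y $ j) x)"

definition chi_vec :: "'d::finite spinor \<Rightarrow> 'd spinor \<Rightarrow> 'd lattice \<Rightarrow> 'd spinor" where
  "chi_vec \<Phi> \<Omega> x = (if x = 0 then \<Omega> else \<Phi>)"

definition coin_at :: "'d::finite spinor \<Rightarrow> 'd spinor \<Rightarrow> 'd spinor" where
  \<comment> \<open>\<open>2|\<phi>\<rangle>\<langle>\<phi>| - 1\<close>; see \<open>coin_at_unique\<close> below\<close>
  "coin_at \<phi> v = scale_sp (2 * cinner_sp \<phi> v) \<phi> - v"

definition coin :: "'d::finite spinor \<Rightarrow> 'd spinor \<Rightarrow> 'd state \<Rightarrow> 'd state" where
  "coin \<Phi> \<Omega> \<Psi> x = coin_at (chi_vec \<Phi> \<Omega> x) (\<Psi> x)"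

definition evolution ::
  "real ^ 'd::finite \<Rightarrow> complex ^ 'd \<Rightarrow> 'd spinor \<Rightarrow> 'd spinor \<Rightarrow> 'd state \<Rightarrow> 'd state" where
  "evolution p q \<Phi> \<Omega> \<Psi> = shift p q (coin \<Phi> \<Omega> \<Psi>)"

definition d_chi :: "'d::finite spinor \<Rightarrow> 'd spinor \<Rightarrow> 'd state \<Rightarrow> 'd lattice \<Rightarrow> complex" where
  "d_chi \<Phi> \<Omega> \<Psi> x = cinner_sp (chi_vec \<Phi> \<Omega> x) (\<Psi> x)"

definition D_plus ::
  "real ^ 'd::finite \<Rightarrow> complex ^ 'd \<Rightarrow> 'd spinor \<Rightarrow> 'd spinor \<Rightarrow> 'd state set" where
  "D_plus p q \<Phi> \<Omega> =
     {\<Psi> \<in> ell2. d_chi \<Phi> \<Omega> \<Psi> = (\<lambda>x. 0)} \<inter> {\<Psi> \<in> ell2. (\<lambda>x. shift p q \<Psi> x + \<Psi> x) = (\<lambda>x. 0)}"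

definition D_minus ::
  "real ^ 'd::finite \<Rightarrow> complex ^ 'd \<Rightarrow> 'd spinor \<Rightarrow> 'd spinor \<Rightarrow> 'd state set" where
  "D_minus p q \<Phi> \<Omega> =
     {\<Psi> \<in> ell2. d_chi \<Phi> \<Omega> \<Psi> = (\<lambda>x. 0)} \<inter> {\<Psi> \<in> ell2. (\<lambda>x. shift p q \<Psi> x - \<Psi> x) = (\<lambda>x. 0)}"

definition D_birth ::
  "real ^ 'd::finite \<Rightarrow> complex ^ 'd \<Rightarrow> 'd spinor \<Rightarrow> 'd spinor \<Rightarrow> 'd state set" where
  "D_birth p q \<Phi> \<Omega> =
     {(\<lambda>x. \<Psi>1 x + \<Psi>2 x) | \<Psi>1 \<Psi>2. \<Psi>1 \<in> D_plus p q \<Phi> \<Omega> \<and> \<Psi>2 \<in> D_minus p q \<Phi> \<Omega>}"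

definition D_inherited ::
  "real ^ 'd::finite \<Rightarrow> complex ^ 'd \<Rightarrow> 'd spinor \<Rightarrow> 'd spinor \<Rightarrow> 'd state set" where
  "D_inherited p q \<Phi> \<Omega> = orth_compl (D_birth p q \<Phi> \<Omega>)"

text \<open>\<open>a_coef \<Phi> p\<close> and \<open>a_coef \<Omega> p\<close> are the quantities \<open>a\<^sub>\<Phi>(p)\<close> and \<open>a\<^sub>\<Omega>(p)\<close>. The inner products
  are real because \<open>sigma3\<close> is Hermitian, so taking \<open>Re\<close> only changes the type
  (see \<open>cinner2_sigma3_real\<close>).\<close>

definition a_coef :: "'d::finite spinor \<Rightarrow> real ^ 'd \<Rightarrow> real" where
  "a_coef V p = (\<Sum>j\<in>UNIV. p $ j * Re (cinner2 (V $ j) (sigma3 *v (V $ j))))"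

definition lambda_coef :: "'d::finite spinor \<Rightarrow> complex ^ 'd \<Rightarrow> real" where
  "lambda_coef \<Phi> q = 2 * (\<Sum>j\<in>UNIV. cmod (q $ j * cinner2 (\<Phi> $ j) (sigma_plus *v (\<Phi> $ j))))"

definition T_minus :: "'d::finite spinor \<Rightarrow> real ^ 'd \<Rightarrow> complex ^ 'd \<Rightarrow> real set" where
  "T_minus \<Phi> p q = {-1 ..< - lambda_coef \<Phi> q + a_coef \<Phi> p}"

definition T_plus :: "'d::finite spinor \<Rightarrow> real ^ 'd \<Rightarrow> complex ^ 'd \<Rightarrow> real set" where
  "T_plus \<Phi> p q = {lambda_coef \<Phi> q + a_coef \<Phi> p <.. 1}"

definition g_plus :: "real \<Rightarrow> complex" where
  "g_plus t = exp (\<i> * complex_of_real (arccos t))"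

definition g_minus :: "real \<Rightarrow> complex" where
  "g_minus t = exp (- \<i> * complex_of_real (arccos t))"


section \<open>Consistency of the encodings\<close>

lemma cinner_sp_self: "cinner_sp v v = complex_of_real ((norm v)\<^sup>2)"
proof -
  have "cinner2 u u = complex_of_real ((norm u)\<^sup>2)" for u
    unfolding cinner2_def norm_vec_def L2_set_def
    by (simp add: sum_nonneg mult.commute[of "cnj _"] flip: complex_norm_square)
  then show ?thesis
    unfolding cinner_sp_def norm_vec_def[of v] L2_set_def by (simp add: sum_nonneg)
qed

lemma cinner2_sigma3_real: "cinner2 u (sigma3 *v u) \<in> \<real>"
  by (simp add: cinner2_def sigma3_def matrix_vector_mult_def sum_2 complex_is_Real_iff algebra_simps)

lemma cinner_sp_add_right: "cinner_sp u (v + w) = cinner_sp u v + cinner_sp u w"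
  by (simp add: cinner_sp_def cinner2_def algebra_simps sum.distrib)

lemma cinner_sp_diff_right: "cinner_sp u (v - w) = cinner_sp u v - cinner_sp u w"
  by (simp add: cinner_sp_def cinner2_def algebra_simps sum_subtractf)

lemma cinner_sp_scale_right: "cinner_sp u (scale_sp c v) = c * cinner_sp u v"
  by (simp add: cinner_sp_def cinner2_def scale_sp_def sum_distrib_left algebra_simps)

lemma cinner_sp_commute: "cnj (cinner_sp u v) = cinner_sp v u"
  by (simp add: cinner_sp_def cinner2_def mult.commute)

text \<open>A unitary, self-adjoint coin whose eigenspace for 1 is the line spanned by the unit
  vector \<open>\<phi>\<close> is \<open>coin_at \<phi>\<close>, and \<open>coin_at \<phi>\<close> has these properties.\<close>

lemma coin_at_unique:
  assumes "norm \<phi> = 1"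
    and lin: "\<And>u v. A (u + v) = A u + A v"
    and iso: "\<And>u v. cinner_sp (A u) (A v) = cinner_sp u v"
    and sa: "\<And>u v. cinner_sp (A u) v = cinner_sp u (A v)"
    and ker: "{v. A v = v} = range (\<lambda>c. scale_sp c \<phi>)"
  shows "A = coin_at \<phi>"
proof
  fix v
  have self: "cinner_sp \<phi> \<phi> = 1" using assms(1) by (simp add: cinner_sp_self)
  have inv: "A (A u) = u" for u
  proof -
    have eq: "cinner_sp w (A (A u) - u) = 0" for w
      using iso[of w u] sa[of w "A u"] by (simp add: cinner_sp_diff_right)
    show ?thesis using eq[of "A (A u) - u"] by (simp add: cinner_sp_self)
  qed
  have "scale_sp 1 \<phi> = \<phi>" by (simp add: scale_sp_def vec_eq_iff)
  then have "\<phi> \<in> range (\<lambda>c. scale_sp c \<phi>)" by (intro range_eqI[of _ _ 1]) simp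
  then have fixphi: "A \<phi> = \<phi>" unfolding ker[symmetric] by simp
  have "A (v + A v) = v + A v" unfolding lin inv by (rule add.commute)
  then have "v + A v \<in> range (\<lambda>c. scale_sp c \<phi>)" unfolding ker[symmetric] by simp
  then obtain c where c: "v + A v = scale_sp c \<phi>" by (rule rangeE)
  have "cinner_sp \<phi> (v + A v) = 2 * cinner_sp \<phi> v"
    unfolding cinner_sp_add_right sa[of \<phi> v, symmetric] fixphi by simp
  then have "c = 2 * cinner_sp \<phi> v" unfolding c cinner_sp_scale_right self by simp
  then have "v + A v = scale_sp (2 * cinner_sp \<phi> v) \<phi>" using c by simp
  then show "A v = coin_at \<phi> v" unfolding coin_at_def by (metis add_diff_cancel_left')
qed

lemma coin_at_props:
  assumes "norm \<phi> = 1"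
  shows "coin_at \<phi> (u + v) = coin_at \<phi> u + coin_at \<phi> v"
    and "coin_at \<phi> (scale_sp c u) = scale_sp c (coin_at \<phi> u)"
    and "cinner_sp (coin_at \<phi> u) (coin_at \<phi> v) = cinner_sp u v"
    and "cinner_sp (coin_at \<phi> u) v = cinner_sp u (coin_at \<phi> v)"
    and "{v. coin_at \<phi> v = v} = range (\<lambda>c. scale_sp c \<phi>)"
proof -
  have self: "cinner_sp \<phi> \<phi> = 1" using assms by (simp add: cinner_sp_self)
  show "coin_at \<phi> (u + v) = coin_at \<phi> u + coin_at \<phi> v"
    by (simp add: coin_at_def cinner_sp_add_right vec_eq_iff scale_sp_def algebra_simps)
  show "coin_at \<phi> (scale_sp c u) = scale_sp c (coin_at \<phi> u)"
    unfolding coin_at_def cinner_sp_scale_right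
    by (simp add: vec_eq_iff scale_sp_def algebra_simps)
  have sa: "cinner_sp (coin_at \<phi> u) v = cinner_sp u (coin_at \<phi> v)" for u v
  proof -
    have "cinner_sp (coin_at \<phi> u) v = cnj (cinner_sp v (coin_at \<phi> u))"
      by (simp add: cinner_sp_commute)
    also have "\<dots> = cinner_sp u (coin_at \<phi> v)"
      by (simp add: coin_at_def cinner_sp_diff_right cinner_sp_scale_right cinner_sp_commute)
    finally show ?thesis .
  qed
  then show "cinner_sp (coin_at \<phi> u) v = cinner_sp u (coin_at \<phi> v)" .
  have inv: "coin_at \<phi> (coin_at \<phi> v) = v" for v
  proof -
    have "cinner_sp \<phi> (coin_at \<phi> v) = cinner_sp \<phi> v"
      by (simp add: coin_at_def cinner_sp_diff_right cinner_sp_scale_right self)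
    then show ?thesis by (simp add: coin_at_def[of \<phi> "coin_at \<phi> v"]) (simp add: coin_at_def)
  qed
  show "cinner_sp (coin_at \<phi> u) (coin_at \<phi> v) = cinner_sp u v" by (simp add: sa inv)
  show "{v. coin_at \<phi> v = v} = range (\<lambda>c. scale_sp c \<phi>)"
  proof (intro set_eqI iffI; clarify)
    fix v assume "coin_at \<phi> v = v"
    then have "scale_sp (2 * cinner_sp \<phi> v) \<phi> = v + v" by (simp add: coin_at_def algebra_simps)
    then have "v = scale_sp (cinner_sp \<phi> v) \<phi>"
      by (simp add: vec_eq_iff scale_sp_def algebra_simps flip: mult_2)
    then show "v \<in> range (\<lambda>c. scale_sp c \<phi>)" by blast
  next
    fix c show "coin_at \<phi> (scale_sp c \<phi>) = scale_sp c \<phi>"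
      unfolding coin_at_def cinner_sp_scale_right self
      by (simp add: vec_eq_iff scale_sp_def algebra_simps)
  qed
qed

end

theory Submission
  imports Defs
begin

text \<open>The discriminant \<open>T = d\<^sub>\<chi> S d\<^sub>\<chi>\<^sup>*\<close> on \<open>\<ell>\<^sup>2(\<int>\<^sup>d)\<close> multiplies by \<open>a\<^sub>\<Omega>(p)\<close> at the origin and by
  \<open>a\<^sub>\<Phi>(p)\<close> elsewhere, up to a nearest-neighbour term \<open>H\<close> of size \<open>O(\<Sum>|q\<^sub>j|)\<close>. Normalizing \<open>f(0) = 1\<close>,
  the equation \<open>T f = \<mu> f\<close> reads \<open>\<mu> = a\<^sub>\<Omega> + (H f)(0)\<close> and
  \<open>(a\<^sub>\<Omega> - a\<^sub>\<Phi> + (H f)(0)) f = H f\<close> off the origin. For small \<open>q\<close> the second equation is a fixed-point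
  problem for a contraction on functions bounded by \<open>2\<^sup>-\<^sup>|\<^sup>x\<^sup>|\<close>, and \<open>\<mu>\<close> stays close to \<open>a\<^sub>\<Omega>(p\<^sub>0)\<close>.
  Since \<open>S\<close> is a symmetric involution, \<open>\<mu>\<close> is real with \<open>|\<mu>| \<le> 1\<close>, and for a root \<open>z\<close> of
  \<open>z\<^sup>2 - 2 \<mu> z + 1\<close> the vector \<open>X - z S X\<close>, where \<open>X = d\<^sub>\<chi>\<^sup>* f\<close>, is an eigenvector of \<open>U\<close> for \<open>z\<close> and is orthogonal
  to the birth eigenspaces.\<close>

section \<open>A contraction on decaying functions\<close>

text \<open>A finite product of discrete spaces has open singletons. Hence every bounded function on
  the lattice can be treated as a bounded continuous function, the setting in which the fixed point
  is found.\<close>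

lemma continuous_on_discrete_vec:
  fixes F :: "('a::discrete_topology) ^ 'd::finite \<Rightarrow> 'b::topological_space"
  shows "continuous_on S F"
proof -
  have "open {x}" for x :: "'a ^ 'd"
    unfolding open_vec_def
    by (auto intro!: exI[of _ "\<lambda>i. {x $ i}"] simp: open_discrete vec_eq_iff)
  then have "open A" for A :: "('a ^ 'd) set"
    using open_UN[of A "\<lambda>x. {x}"] by simp
  then show ?thesis
    unfolding continuous_on_open_invariant by (metis Int_absorb2 inf_le1 vimage_def)
qed

text \<open>The library instance requires a metric on the domain, which \<open>int\<close> does not have.\<close>

lemma complete_bcontfun: "complete (UNIV :: ('a::topological_space \<Rightarrow>\<^sub>C 'b::complete_space) set)"
  unfolding complete_def
proof safe
  fix F :: "nat \<Rightarrow> 'a \<Rightarrow>\<^sub>C 'b"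
  assume "Cauchy F"
  then obtain g where "uniform_limit UNIV (\<lambda>n. apply_bcontfun (F n)) g sequentially"
    using uniformly_convergent_eq_cauchy[of "\<lambda>_. True" "\<lambda>n. apply_bcontfun (F n)"]
    unfolding Cauchy_def uniform_limit_sequentially_iff by (metis dist_fun_lt_imp_dist_val_lt)
  then show "\<exists>G\<in>UNIV. F \<longlonglongrightarrow> G"
    by (rule uniform_limit_bcontfunE) auto
qed

text \<open>Lipschitz estimate for a quotient: the difference equals
  \<open>((a - a') - (a' / b') * (b - b')) / b\<close>, and \<open>k\<close> bounds
  \<open>a' / b'\<close>.\<close>

lemma norm_quotient_diff_le:
  fixes a b a' b' :: complex
  assumes "cmod (a - a') \<le> e" "cmod (b - b') \<le> e" "cmod a' \<le> k * e'" "k \<ge> 0"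
    and "cmod b \<ge> e'" "cmod b' \<ge> e'" "e' > 0"
  shows "cmod (a / b - a' / b') \<le> (1 + k) * e / e'"
proof -
  have nz: "b \<noteq> 0" "b' \<noteq> 0" using assms by auto
  have "e \<ge> 0" using assms(1) norm_ge_zero order_trans by blast
  have eq: "a / b - a' / b' = ((a - a') - (a' / b') * (b - b')) / b"
    using nz by (simp add: field_simps)
  have "cmod (a' / b') \<le> k * e' / e'"
    unfolding norm_divide using assms by (intro frac_le) auto
  then have q: "cmod (a' / b') \<le> k" using assms by simp
  have "cmod ((a - a') - (a' / b') * (b - b')) \<le> cmod (a - a') + cmod (a' / b') * cmod (b - b')"
    using norm_triangle_ineq4[of "a - a'" "(a' / b') * (b - b')"] by (simp only: norm_mult)
  also have "\<dots> \<le> e + k * e"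
    using assms q \<open>e \<ge> 0\<close> by (intro add_mono mult_mono) auto
  finally have "cmod ((a - a') - (a' / b') * (b - b')) \<le> (1 + k) * e" by (simp add: algebra_simps)
  then show ?thesis
    unfolding eq norm_divide[of "_ - _"] using assms \<open>e \<ge> 0\<close> by (intro frac_le) auto
qed

text \<open>Abstract form of the equation off the origin: \<open>H\<close> stands for the hopping
  term, \<open>c\<close> for the difference of the two diagonal values and \<open>o'\<close> for the
  defect site. Writing \<open>f = w * F\<close> turns the equation into a fixed-point problem for
  \<open>F\<close> in the unit ball of bounded functions, where Banach's theorem applies.\<close>

lemma decaying_solution:
  fixes H :: "('d::finite lattice \<Rightarrow> complex) \<Rightarrow> 'd lattice \<Rightarrow> complex" and w :: "'d lattice \<Rightarrow> real"
  assumes w: "\<And>x. w x > 0" "w o' = 1"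
    and diff: "\<And>f g x. H (\<lambda>y. f y - g y) x = H f x - H g x"
    and bound: "\<And>f M x. (\<And>y. cmod (f y) \<le> M * w y) \<Longrightarrow> cmod (H f x) \<le> \<eta> * M * w x"
    and gap: "8 * \<eta> \<le> cmod c" "c \<noteq> 0" "\<eta> \<ge> 0"
  obtains f where "f o' = 1" "\<And>x. cmod (f x) \<le> w x"
    "\<And>x. x \<noteq> o' \<Longrightarrow> (c + H f o') * f x = H f x"
proof -
  \<comment> \<open>conjugated by the weight, so that decaying functions become bounded ones\<close>
  define K where "K f = H (\<lambda>y. of_real (w y) * f y)" for f
  \<comment> \<open>The value 1 at \<open>o'\<close> is the normalization; it agrees with
    \<open>f o' = 1\<close> after multiplication by the weight because
    \<open>w o' = 1\<close>.\<close>
  define R where "R f x = (if x = o' then 1 else K f x / (c + K f o') / of_real (w x))" for f x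
  have K: "cmod (K f x) \<le> \<eta> * M * w x" if "\<And>y. cmod (f y) \<le> M" for f M x
    unfolding K_def using that w(1)
    by (intro bound) (simp add: norm_mult less_imp_le mult.commute mult_left_mono)
  have Kdiff: "cmod (K f x - K g x) \<le> \<eta> * M * w x" if "\<And>y. cmod (f y - g y) \<le> M" for f g M x
    using K[of "\<lambda>y. f y - g y" M x] that by (simp add: K_def diff[symmetric] algebra_simps)
  have c0: "cmod c > 0" using gap by simp
  \<comment> \<open>On the unit ball \<open>K f o'\<close> is at most \<open>\<eta>\<close>, which
    is at most an eighth of \<open>cmod c\<close>, so the denominator stays away from zero.\<close>
  have den: "cmod (c + K f o') \<ge> 7 / 8 * cmod c" if "\<And>y. cmod (f y) \<le> 1" for f
    using K[of f 1 o', OF that] norm_diff_ineq[of c "K f o'"] gap w by simp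
  have K78: "cmod (K f x) \<le> (7 / 8 * cmod c) * w x" if f: "\<And>y. cmod (f y) \<le> 1" for f x
  proof -
    have "cmod (K f x) \<le> \<eta> * w x" using K[of f 1 x] f by simp
    also have "\<dots> \<le> (7 / 8 * cmod c) * w x"
      using gap w(1)[of x] c0 by (intro mult_right_mono) auto
    finally show ?thesis .
  qed
  have R1: "cmod (R f x) \<le> 1" if f: "\<And>y. cmod (f y) \<le> 1" for f x
  proof (cases "x = o'")
    case False
    have "cmod (K f x) \<le> (7 / 8 * cmod c) * w x" by (rule K78[of f x, OF f])
    also have "\<dots> \<le> cmod (c + K f o') * w x"
      using den f w(1)[of x] by (intro mult_right_mono) auto
    finally show ?thesis
      using False w(1)[of x] den[of f] f c0
      by (simp add: R_def norm_divide norm_mult divide_divide_eq_left mult.commute)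
         (auto intro!: divide_le_eq_1[THEN iffD2] simp: mult.commute)
  qed (simp add: R_def)
  \<comment> \<open>Numerator and denominator each move by at most \<open>\<eta> * M\<close>, and
    the quotient is at most 1. The resulting Lipschitz constant \<open>16 \<eta> / (7 |c|)\<close>
    is at most \<open>2/7\<close>, hence below \<open>1/2\<close>.\<close>
  have R2: "cmod (R f x - R g x) \<le> 1 / 2 * M"
    if f: "\<And>y. cmod (f y) \<le> 1" and g: "\<And>y. cmod (g y) \<le> 1"
      and fg: "\<And>y. cmod (f y - g y) \<le> M" for f g x M
  proof (cases "x = o'")
    case False
    have M: "M \<ge> 0" using fg[of x] norm_ge_zero order_trans by blast
    have wx: "of_real (w x) \<noteq> (0::complex)" using w(1)[of x] by simp
    have "cmod (K f x / of_real (w x) - K g x / of_real (w x)) \<le> \<eta> * M"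
      using Kdiff[of f g M x, OF fg] w(1)[of x]
      by (simp add: diff_divide_distrib[symmetric] norm_divide divide_simps mult.commute)
    moreover have "cmod ((c + K f o') - (c + K g o')) \<le> \<eta> * M"
      using Kdiff[of f g M o', OF fg] w(2) by simp
    moreover have "cmod (K g x / of_real (w x)) \<le> 1 * (7 / 8 * cmod c)"
      using K78[of g x, OF g] w(1)[of x] by (simp add: norm_divide pos_divide_le_eq)
    ultimately have "cmod (K f x / of_real (w x) / (c + K f o') - K g x / of_real (w x) / (c + K g o'))
        \<le> (1 + 1) * (\<eta> * M) / (7 / 8 * cmod c)"
      using den[of f] den[of g] f g c0 by (intro norm_quotient_diff_le) auto
    also have "\<dots> = (8 * \<eta>) * (2 / 7 * M) / cmod c" by simp
    also have "\<dots> \<le> cmod c * (2 / 7 * M) / cmod c"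
      using gap M c0 by (intro divide_right_mono mult_right_mono) auto
    also have "\<dots> \<le> 1 / 2 * M" using c0 M by simp
    finally show ?thesis using False by (simp add: R_def divide_simps mult.commute mult.left_commute)
  next
    case True
    then show ?thesis using order_trans[OF norm_ge_zero fg[of x]] by (simp add: R_def)
  qed
  define X where "X = {F :: 'd lattice \<Rightarrow>\<^sub>C complex. \<forall>x. cmod (apply_bcontfun F x) \<le> 1}"
  define T where "T F = Bcontfun (R (apply_bcontfun F))" for F :: "'d lattice \<Rightarrow>\<^sub>C complex"
  \<comment> \<open>\<open>Bcontfun\<close> can be inverted only on bounded continuous maps:
    boundedness is \<open>R1\<close>, and continuity is automatic on the discrete lattice.\<close>
  have T: "apply_bcontfun (T F) = R (apply_bcontfun F)" if "F \<in> X" for F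
    unfolding T_def
  proof (rule Bcontfun_inverse, rule bcontfun_normI)
    show "cmod (R (apply_bcontfun F) x) \<le> 1" for x using that by (intro R1) (simp add: X_def)
  qed (rule continuous_on_discrete_vec)
  have Xball: "X = cball 0 1"
  proof (intro set_eqI iffI)
    show "F \<in> cball 0 1" if "F \<in> X" for F
      using that Bounded_Continuous_Function.norm_bound[of F 1] by (simp add: X_def)
    show "F \<in> X" if "F \<in> cball 0 1" for F
      using that order_trans[OF norm_bounded[of F]] by (simp add: X_def)
  qed
  have "\<exists>!F\<in>X. T F = F"
  proof (rule Banach_fix[of X "1/2"])
    show "complete X" unfolding Xball
      by (rule complete_closed_subset[OF closed_cball subset_UNIV complete_bcontfun])
    show "X \<noteq> {}" unfolding Xball by simp
    show "T ` X \<subseteq> X"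
    proof
      fix G assume "G \<in> T ` X"
      then obtain F where F: "F \<in> X" "G = T F" by blast
      then show "G \<in> X" using T[OF F(1)] R1[of "apply_bcontfun F"] by (simp add: X_def)
    qed
    show "dist (T F) (T G) \<le> 1 / 2 * dist F G" if "F \<in> X" "G \<in> X" for F G
    proof (rule dist_bound)
      fix x
      show "dist (apply_bcontfun (T F) x) (apply_bcontfun (T G) x) \<le> 1 / 2 * dist F G"
        using that R2[of "apply_bcontfun F" "apply_bcontfun G" "dist F G" x]
        by (simp add: T X_def dist_norm[symmetric] dist_bounded)
    qed
  qed auto
  then obtain F where F: "F \<in> X" "T F = F" by blast
  \<comment> \<open>Multiplying the weight back in gives the decaying solution.\<close>
  define f where "f x = of_real (w x) * apply_bcontfun F x" for x
  have fix_eq: "apply_bcontfun F x = R (apply_bcontfun F) x" for x using F T by metis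
  have Kf: "K (apply_bcontfun F) = H f" unfolding K_def f_def by simp
  show thesis
  proof (rule that[of f])
    show "f o' = 1" using fix_eq[of o'] w by (simp add: f_def R_def)
    show "cmod (f x) \<le> w x" for x
      using F(1) w(1)[of x] by (auto simp: f_def norm_mult X_def)
    show "(c + H f o') * f x = H f x" if "x \<noteq> o'" for x
    proof -
      have "c + H f o' \<noteq> 0" using den[of "apply_bcontfun F"] F(1) c0 by (auto simp: X_def Kf)
      moreover have "of_real (w x) \<noteq> (0::complex)" using w(1)[of x] by simp
      ultimately show ?thesis
        using that fix_eq[of x] by (simp add: f_def[of x] R_def Kf)
    qed
  qed
qed

section \<open>A square-summable weight on the lattice\<close>

definition l1_weight :: "'d::finite lattice \<Rightarrow> real" where
  "l1_weight x = (1/2) ^ (\<Sum>i\<in>UNIV. nat \<bar>x $ i\<bar>)"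

lemma l1_weight_pos: "l1_weight x > 0"
  by (simp add: l1_weight_def)

lemma l1_weight_0 [simp]: "l1_weight 0 = 1"
  by (simp add: l1_weight_def)

text \<open>One lattice step changes the l1 norm by at most one. This is what lets the
  nearest-neighbour operator preserve bounds by the weight.\<close>

lemma l1_weight_neighbour:
  assumes "\<bar>s\<bar> = 1"
  shows "l1_weight (x + axis j s) \<le> 2 * l1_weight x"
proof -
  have "(\<Sum>i\<in>UNIV. nat \<bar>x $ i\<bar>) \<le> (\<Sum>i\<in>UNIV. nat \<bar>(x + axis j s) $ i\<bar> + (if i = j then 1 else 0))"
    using assms by (intro sum_mono) (auto simp: axis_def)
  also have "\<dots> = Suc (\<Sum>i\<in>UNIV. nat \<bar>(x + axis j s) $ i\<bar>)" by (simp add: sum.distrib)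
  finally have "(1/2::real) ^ Suc (\<Sum>i\<in>UNIV. nat \<bar>(x + axis j s) $ i\<bar>) \<le> (1/2) ^ (\<Sum>i\<in>UNIV. nat \<bar>x $ i\<bar>)"
    by (intro power_decreasing) auto
  then show ?thesis by (simp add: l1_weight_def)
qed

text \<open>The integers are covered by the images of \<open>int\<close> and of its negative, each
  carrying a geometric series; the overlap at 0 is harmless.\<close>

lemma geometric_summable_on_int:
  fixes r :: real
  assumes "0 \<le> r" "r < 1"
  shows "(\<lambda>k::int. r ^ nat \<bar>k\<bar>) summable_on UNIV"
proof -
  have n: "(\<lambda>n::nat. r ^ n) summable_on UNIV"
    using assms by (intro summable_nonneg_imp_summable_on) auto
  have "(\<lambda>k::int. r ^ nat \<bar>k\<bar>) summable_on range int"
    using n by (subst summable_on_reindex) (auto simp: o_def inj_on_def)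
  moreover have "(\<lambda>k::int. r ^ nat \<bar>k\<bar>) summable_on range (\<lambda>n. - int n)"
    using n by (subst summable_on_reindex) (auto simp: o_def inj_on_def)
  ultimately have "(\<lambda>k::int. r ^ nat \<bar>k\<bar>) summable_on (range int \<union> range (\<lambda>n. - int n))"
    by (rule summable_on_union)
  also have "range int \<union> range (\<lambda>n. - int n) = UNIV"
    by (auto simp: image_iff) (metis int_cases2)
  finally show ?thesis .
qed

text \<open>The squared weight factorizes into \<open>(1/4) ^ nat \<bar>x $ i\<bar>\<close> over the
  coordinates, so the lattice sum is a finite product of geometric series.\<close>

lemma l1_weight_sq_summable: "(\<lambda>x::'d::finite lattice. (l1_weight x)\<^sup>2) summable_on UNIV"
proof -
  have "(\<lambda>k::int. (1/4::real) ^ nat \<bar>k\<bar>) summable_on UNIV"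
    by (rule geometric_summable_on_int) auto
  then have "Infinite_Set_Sum.abs_summable_on (\<lambda>k::int. (1/4::real) ^ nat \<bar>k\<bar>) UNIV"
    by (simp flip: abs_summable_equivalent)
  \<comment> \<open>The product rule is stated for functions in a \<open>PiE\<close>;
    \<open>vec_nth\<close> later carries the result over to vectors.\<close>
  then have "Infinite_Set_Sum.abs_summable_on
      (\<lambda>g. \<Prod>i\<in>(UNIV::'d set). (1/4::real) ^ nat \<bar>g i\<bar>) (PiE UNIV (\<lambda>_. UNIV))"
    by (intro abs_summable_on_prod_PiE) auto
  then have "(\<lambda>g. \<Prod>i\<in>(UNIV::'d set). (1/4::real) ^ nat \<bar>g i\<bar>) summable_on UNIV"
    by (simp flip: abs_summable_equivalent add: abs_prod PiE_UNIV_domain)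
  then have "(\<lambda>x::'d lattice. \<Prod>i\<in>UNIV. (1/4::real) ^ nat \<bar>x $ i\<bar>) summable_on UNIV"
    by (subst summable_on_reindex_bij_betw[where g = vec_nth])
       (auto intro!: bij_betwI[of _ _ _ vec_lambda])
  then show ?thesis
    by (simp add: l1_weight_def power_sum prod_power_distrib power_one_over
        flip: power_mult power_mult_distrib)
       (simp add: power_mult mult.commute)
qed

section \<open>Symmetry of the shift\<close>

lemma has_sum_finite_sum:
  fixes f :: "'i \<Rightarrow> 'a \<Rightarrow> 'b::topological_comm_monoid_add"
  assumes "finite I" "\<And>i. i \<in> I \<Longrightarrow> (f i has_sum s i) A"
  shows "((\<lambda>x. \<Sum>i\<in>I. f i x) has_sum (\<Sum>i\<in>I. s i)) A"
  using assms
proof (induction I rule: finite_induct)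
  case (insert i I)
  then have "((\<lambda>x. f i x + (\<Sum>i\<in>I. f i x)) has_sum (s i + (\<Sum>i\<in>I. s i))) A"
    by (intro has_sum_add) simp_all
  then show ?case using insert.hyps by simp
qed simp

lemma summable_on_finite_sum:
  fixes f :: "'i \<Rightarrow> 'a \<Rightarrow> 'b::{topological_comm_monoid_add, t2_space}"
  assumes "finite I" "\<And>i. i \<in> I \<Longrightarrow> f i summable_on A"
  shows "(\<lambda>x. \<Sum>i\<in>I. f i x) summable_on A"
  using has_sum_finite_sum[OF assms(1) has_sum_infsum[OF assms(2)]] by (rule has_sum_imp_summable)

section \<open>Square-summable functions and their inner product\<close>

lemma ell2_dominated:
  assumes "u \<in> ell2" "\<And>x. norm (v x) \<le> norm (u x)"
  shows "v \<in> ell2"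
  using assms unfolding ell2_def
  by (auto intro!: summable_on_comparison_test[of "\<lambda>x. (norm (u x))\<^sup>2"] power_mono)

lemma ell2_add:
  assumes "u \<in> ell2" "v \<in> ell2"
  shows "(\<lambda>x. u x + v x) \<in> ell2"
proof -
  have "(norm (u x + v x))\<^sup>2 \<le> 2 * (norm (u x))\<^sup>2 + 2 * (norm (v x))\<^sup>2" for x
  proof -
    have "(norm (u x + v x))\<^sup>2 \<le> (norm (u x) + norm (v x))\<^sup>2"
      by (intro power_mono norm_triangle_ineq) auto
    also have "\<dots> \<le> 2 * (norm (u x))\<^sup>2 + 2 * (norm (v x))\<^sup>2"
      using sum_squares_bound[of "norm (u x)" "norm (v x)"] by (simp add: power2_sum)
    finally show ?thesis .
  qed
  moreover have "(\<lambda>x. 2 * (norm (u x))\<^sup>2 + 2 * (norm (v x))\<^sup>2) summable_on UNIV"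
    using assms by (auto simp: ell2_def intro!: summable_on_add summable_on_cmult_right)
  ultimately show ?thesis
    unfolding ell2_def by (auto intro: summable_on_comparison_test)
qed

lemma ell2_cmult:
  fixes u :: "'a \<Rightarrow> complex"
  assumes "u \<in> ell2"
  shows "(\<lambda>x. c * u x) \<in> ell2"
  using assms by (auto simp: ell2_def norm_mult power_mult_distrib intro: summable_on_cmult_right)

lemma ell2_translate:
  fixes u :: "'a::group_add \<Rightarrow> 'b::real_normed_vector"
  assumes "u \<in> ell2"
  shows "(\<lambda>x. u (x + a)) \<in> ell2"
proof -
  have "bij (\<lambda>x. x + a)" by (rule bij_betw_byWitness[of _ "\<lambda>x. x - a"]) auto
  then show ?thesis
    using assms summable_on_reindex_bij_betw[of "\<lambda>x. x + a" UNIV UNIV "\<lambda>x. (norm (u x))\<^sup>2"]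
    by (simp add: ell2_def)
qed

text \<open>Absolute convergence from the arithmetic-geometric inequality, applied
  pointwise.\<close>

lemma ell2_product_summable:
  fixes u v :: "'a \<Rightarrow> complex"
  assumes "u \<in> ell2" "v \<in> ell2"
  shows "(\<lambda>x. cnj (u x) * v x) summable_on UNIV"
proof (rule abs_summable_summable, rule Infinite_Sum.abs_summable_on_comparison_test')
  show "(\<lambda>x. (cmod (u x))\<^sup>2 + (cmod (v x))\<^sup>2) summable_on UNIV"
    using assms by (auto simp: ell2_def intro: summable_on_add)
  show "cmod (cnj (u x) * v x) \<le> (cmod (u x))\<^sup>2 + (cmod (v x))\<^sup>2" for x
    using sum_squares_bound[of "cmod (u x)" "cmod (v x)"]
      mult_nonneg_nonneg[OF norm_ge_zero[of "u x"] norm_ge_zero[of "v x"]]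
    unfolding norm_mult complex_mod_cnj by linarith
qed

lemma norm_sq_spinor:
  "(norm (v :: 'd::finite spinor))\<^sup>2 = (\<Sum>j\<in>UNIV. (cmod (v $ j $ 1))\<^sup>2 + (cmod (v $ j $ 2))\<^sup>2)"
  by (simp add: norm_vec_def L2_set_def sum_nonneg sum_2)

lemma cmod_entry_le_norm: "cmod (v $ j $ i) \<le> norm (v :: 'd::finite spinor)"
  by (rule order_trans[OF Finite_Cartesian_Product.norm_nth_le Finite_Cartesian_Product.norm_nth_le])

lemma ell2_spinor_iff:
  fixes \<Psi> :: "'a \<Rightarrow> 'd::finite spinor"
  shows "\<Psi> \<in> ell2 \<longleftrightarrow> (\<forall>j i. (\<lambda>x. \<Psi> x $ j $ i) \<in> ell2)"
proof
  assume "\<forall>j i. (\<lambda>x. \<Psi> x $ j $ i) \<in> ell2"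
  then have "(\<lambda>x. (norm (\<Psi> x))\<^sup>2) summable_on UNIV"
    unfolding norm_sq_spinor ell2_def mem_Collect_eq
    by (intro summable_on_finite_sum summable_on_add) auto
  then show "\<Psi> \<in> ell2" by (simp add: ell2_def)
qed (auto intro: ell2_dominated cmod_entry_le_norm)

lemma ell2_scale_sp: "\<Psi> \<in> ell2 \<Longrightarrow> (\<lambda>x. scale_sp c (\<Psi> x)) \<in> ell2"
  by (simp add: ell2_spinor_iff scale_sp_def ell2_cmult)

lemma cinner_sp_summable:
  assumes "\<Theta> \<in> ell2" "\<Psi> \<in> ell2"
  shows "(\<lambda>x. cinner_sp (\<Theta> x) (\<Psi> x)) summable_on UNIV"
proof -
  have "(\<lambda>x. cnj (\<Theta> x $ j $ i) * \<Psi> x $ j $ i) summable_on UNIV" for j i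
    using assms by (intro ell2_product_summable) (auto simp: ell2_spinor_iff)
  then show ?thesis
    unfolding cinner_sp_def cinner2_def by (intro summable_on_finite_sum) auto
qed

lemma cinner_ell2_cnj: "cnj (cinner_ell2 \<Theta> \<Psi>) = cinner_ell2 \<Psi> \<Theta>"
  unfolding cinner_ell2_def infsum_cnj[symmetric] cinner_sp_commute ..

lemma cinner_ell2_diff_right:
  assumes "\<Theta> \<in> ell2" "\<Psi> \<in> ell2" "\<Psi>' \<in> ell2"
  shows "cinner_ell2 \<Theta> (\<lambda>x. \<Psi> x - scale_sp c (\<Psi>' x)) = cinner_ell2 \<Theta> \<Psi> - c * cinner_ell2 \<Theta> \<Psi>'"
proof -
  have "((\<lambda>x. cinner_sp (\<Theta> x) (\<Psi> x) + (- c) * cinner_sp (\<Theta> x) (\<Psi>' x))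
      has_sum (cinner_ell2 \<Theta> \<Psi> + (- c) * cinner_ell2 \<Theta> \<Psi>')) UNIV"
    unfolding cinner_ell2_def
    by (intro has_sum_add has_sum_cmult_right has_sum_infsum cinner_sp_summable assms)
  from infsumI[OF this] show ?thesis
    by (simp add: cinner_ell2_def cinner_sp_diff_right cinner_sp_scale_right)
qed

lemma cinner_ell2_self:
  assumes "\<Psi> \<in> ell2"
  shows "cinner_ell2 \<Psi> \<Psi> = of_real (\<Sum>\<^sub>\<infinity>x. (norm (\<Psi> x))\<^sup>2)"
  unfolding cinner_ell2_def cinner_sp_self
  using assms by (intro infsumI has_sum_of_real has_sum_infsum) (simp add: ell2_def)

section \<open>The shift as a symmetric involution\<close>

lemma shift_comp_nth [simp]:
  "shift_comp a b j \<psi> x $ 1 = complex_of_real a * \<psi> x $ 1 + b * \<psi> (x + axis j 1) $ 2"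
  "shift_comp a b j \<psi> x $ 2 = cnj b * \<psi> (x - axis j 1) $ 1 - complex_of_real a * \<psi> x $ 2"
  by (simp_all add: shift_comp_def)

lemma shift_nth [simp]: "shift p q \<Psi> x $ j = shift_comp (p $ j) (q $ j) j (\<lambda>y. \<Psi> y $ j) x"
  by (simp add: shift_def)

lemma shift_linear:
  "shift p q (\<lambda>x. scale_sp a (\<Psi> x) + scale_sp b (\<Theta> x)) x
     = scale_sp a (shift p q \<Psi> x) + scale_sp b (shift p q \<Theta> x)"
  by (simp add: vec_eq_iff forall_2 scale_sp_def algebra_simps)

text \<open>In each block the mixed terms cancel, the translations by \<open>axis j 1\<close> and
  its negative undo each other, and the diagonal factor is
  \<open>p\<^sub>j\<^sup>2 + |q\<^sub>j|\<^sup>2 = 1\<close>.\<close>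

lemma shift_shift:
  assumes "(p, q) \<in> paramD"
  shows "shift p q (shift p q \<Psi>) = \<Psi>"
proof -
  have "complex_of_real (p $ j) * p $ j + q $ j * cnj (q $ j) = 1" for j
  proof -
    have "(p $ j)\<^sup>2 + (cmod (q $ j))\<^sup>2 = 1" using assms by (simp add: paramD_def)
    then have "complex_of_real ((p $ j)\<^sup>2 + (cmod (q $ j))\<^sup>2) = 1" by simp
    then show ?thesis unfolding of_real_add complex_norm_square by (simp add: power2_eq_square)
  qed
  moreover have "complex_of_real (p $ j) * (complex_of_real (p $ j) * a + q $ j * b) + q $ j * (cnj (q $ j) * a - complex_of_real (p $ j) * b)
      = (complex_of_real (p $ j) * p $ j + q $ j * cnj (q $ j)) * a" for j a b
    by (simp add: algebra_simps)
  moreover have "cnj (q $ j) * (complex_of_real (p $ j) * a + q $ j * b) - p $ j * (cnj (q $ j) * a - complex_of_real (p $ j) * b)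
      = (complex_of_real (p $ j) * p $ j + q $ j * cnj (q $ j)) * b" for j a b
    by (simp add: algebra_simps)
  ultimately show ?thesis
    by (intro ext) (simp add: vec_eq_iff forall_2)
qed

lemma ell2_shift:
  assumes "\<Psi> \<in> ell2"
  shows "shift p q \<Psi> \<in> ell2"
proof -
  have e: "(\<lambda>x. \<Psi> x $ j $ i) \<in> ell2" for j i using assms by (simp add: ell2_spinor_iff)
  have c: "(\<lambda>x. a * \<Psi> (x + y) $ j $ i + b * \<Psi> (x + y') $ j' $ i') \<in> ell2" for a b y y' j i j' i'
    by (intro ell2_add ell2_cmult ell2_translate[of "\<lambda>x. \<Psi> x $ _ $ _"] e)
  show ?thesis
    unfolding ell2_spinor_iff forall_2
  proof (intro allI conjI)
    fix j
    show "(\<lambda>x. shift p q \<Psi> x $ j $ 1) \<in> ell2"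
      using c[where a = "of_real (p $ j)" and y = 0 and j = j and i = 1
          and b = "q $ j" and y' = "axis j 1" and j' = j and i' = 2] by simp
    show "(\<lambda>x. shift p q \<Psi> x $ j $ 2) \<in> ell2"
      using c[where a = "cnj (q $ j)" and y = "- axis j 1" and j = j and i = 1
          and b = "- of_real (p $ j)" and y' = 0 and j' = j and i' = 2] by simp
  qed
qed

text \<open>Both sums expand into the same four correlations \<open>S i k y\<close>, since
  translating the summation variable moves the shift from one argument to the other. A common value
  \<open>s\<close> records summability together with equality, so that the blocks can be added
  afterwards.\<close>

lemma cinner2_shift_comp_symmetric:
  assumes "\<And>i. (\<lambda>x. \<theta> x $ i) \<in> ell2" "\<And>i. (\<lambda>x. \<psi> x $ i) \<in> ell2"
  obtains s where "((\<lambda>x. cinner2 (shift_comp a b j \<theta> x) (\<psi> x)) has_sum s) UNIV"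
    and "((\<lambda>x. cinner2 (\<theta> x) (shift_comp a b j \<psi> x)) has_sum s) UNIV"
proof -
  define e :: "'a lattice" where "e = axis j 1"
  have bij: "bij (\<lambda>x. x + y)" for y :: "'a lattice"
    by (rule bij_betw_byWitness[of _ "\<lambda>x. x - y"]) auto
  define S where "S i k y = (\<Sum>\<^sub>\<infinity>x. cnj (\<theta> x $ i) * \<psi> (x + y) $ k)" for i k y
  have S: "((\<lambda>x. cnj (\<theta> x $ i) * \<psi> (x + y) $ k) has_sum S i k y) UNIV" for i k y
    unfolding S_def
    by (intro has_sum_infsum ell2_product_summable assms ell2_translate[of "\<lambda>x. \<psi> x $ _"])
  have S': "((\<lambda>x. cnj (\<theta> (x - y) $ i) * \<psi> x $ k) has_sum S i k y) UNIV" for i k y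
    using S[of i y k] has_sum_reindex_bij_betw[OF bij[of "- y"], of "\<lambda>x. cnj (\<theta> x $ i) * \<psi> (x + y) $ k"]
    by simp
  define s where "s = a * S 1 1 0 + b * S 1 2 e + (cnj b * S 2 1 (- e) + (- of_real a) * S 2 2 0)"
  show thesis
  proof (rule that[of s])
    have "((\<lambda>x. a * (cnj (\<theta> (x - 0) $ 1) * \<psi> x $ 1) + b * (cnj (\<theta> (x - e) $ 1) * \<psi> x $ 2)
        + (cnj b * (cnj (\<theta> (x - (- e)) $ 2) * \<psi> x $ 1) + (- of_real a) * (cnj (\<theta> (x - 0) $ 2) * \<psi> x $ 2)))
        has_sum s) UNIV"
      unfolding s_def by (intro has_sum_add has_sum_cmult_right S')
    then show "((\<lambda>x. cinner2 (shift_comp a b j \<theta> x) (\<psi> x)) has_sum s) UNIV"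
      by (simp add: cinner2_def sum_2 e_def algebra_simps)
    have "((\<lambda>x. a * (cnj (\<theta> x $ 1) * \<psi> (x + 0) $ 1) + b * (cnj (\<theta> x $ 1) * \<psi> (x + e) $ 2)
        + (cnj b * (cnj (\<theta> x $ 2) * \<psi> (x + (- e)) $ 1) + (- of_real a) * (cnj (\<theta> x $ 2) * \<psi> (x + 0) $ 2)))
        has_sum s) UNIV"
      unfolding s_def by (intro has_sum_add has_sum_cmult_right S)
    then show "((\<lambda>x. cinner2 (\<theta> x) (shift_comp a b j \<psi> x)) has_sum s) UNIV"
      by (simp add: cinner2_def sum_2 e_def algebra_simps)
  qed
qed

lemma cinner_ell2_shift:
  fixes \<Theta> \<Psi> :: "'d::finite state"
  assumes "\<Theta> \<in> ell2" "\<Psi> \<in> ell2"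
  shows "cinner_ell2 (shift p q \<Theta>) \<Psi> = cinner_ell2 \<Theta> (shift p q \<Psi>)"
proof -
  have ex: "\<exists>s. ((\<lambda>x. cinner2 (shift p q \<Theta> x $ j) (\<Psi> x $ j)) has_sum s) UNIV \<and>
      ((\<lambda>x. cinner2 (\<Theta> x $ j) (shift p q \<Psi> x $ j)) has_sum s) UNIV" for j
  proof -
    have comp: "(\<lambda>x. \<Theta> x $ j $ i) \<in> ell2" "(\<lambda>x. \<Psi> x $ j $ i) \<in> ell2" for i
      using assms by (simp_all add: ell2_spinor_iff)
    obtain s where s:
      "((\<lambda>x. cinner2 (shift_comp (p $ j) (q $ j) j (\<lambda>y. \<Theta> y $ j) x) (\<Psi> x $ j)) has_sum s) UNIV"
      "((\<lambda>x. cinner2 (\<Theta> x $ j) (shift_comp (p $ j) (q $ j) j (\<lambda>y. \<Psi> y $ j) x)) has_sum s) UNIV"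
      by (rule cinner2_shift_comp_symmetric[of "\<lambda>y. \<Theta> y $ j" "\<lambda>y. \<Psi> y $ j" "p $ j" "q $ j" j,
            OF comp])
    show ?thesis unfolding shift_nth by (rule exI[of _ s], rule conjI[OF s])
  qed
  define s where "s j = (SOME s. ((\<lambda>x. cinner2 (shift p q \<Theta> x $ j) (\<Psi> x $ j)) has_sum s) UNIV \<and>
      ((\<lambda>x. cinner2 (\<Theta> x $ j) (shift p q \<Psi> x $ j)) has_sum s) UNIV)" for j
  have s: "((\<lambda>x. cinner2 (shift p q \<Theta> x $ j) (\<Psi> x $ j)) has_sum s j) UNIV \<and>
      ((\<lambda>x. cinner2 (\<Theta> x $ j) (shift p q \<Psi> x $ j)) has_sum s j) UNIV" for j
    unfolding s_def by (rule someI_ex[OF ex])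
  have "cinner_ell2 (shift p q \<Theta>) \<Psi> = (\<Sum>j\<in>UNIV. s j)"
    unfolding cinner_ell2_def cinner_sp_def
    by (intro infsumI has_sum_finite_sum finite s[THEN conjunct1])
  moreover have "cinner_ell2 \<Theta> (shift p q \<Psi>) = (\<Sum>j\<in>UNIV. s j)"
    unfolding cinner_ell2_def cinner_sp_def
    by (intro infsumI has_sum_finite_sum finite s[THEN conjunct2])
  ultimately show ?thesis by simp
qed

section \<open>From the discriminant to the evolution\<close>

lemma norm_scale_sp: "norm (scale_sp c v) = cmod c * norm (v :: 'd::finite spinor)"
proof -
  have "(norm (scale_sp c v))\<^sup>2 = (cmod c * norm v)\<^sup>2"
    unfolding power_mult_distrib norm_sq_spinor
    by (simp add: scale_sp_def norm_mult power_mult_distrib sum_distrib_left distrib_left)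
  then show ?thesis by simp
qed

lemma scale_sp_1 [simp]: "scale_sp 1 v = v"
  by (simp add: scale_sp_def)

lemma scale_sp_scale_sp: "scale_sp a (scale_sp b v) = scale_sp (a * b) v"
  by (simp add: scale_sp_def vec_eq_iff)

lemma cinner_sp_scale_left: "cinner_sp (scale_sp c u) v = cnj c * cinner_sp u v"
  by (simp add: cinner_sp_def cinner2_def scale_sp_def sum_distrib_left algebra_simps)

lemma norm_chi_vec: "norm \<Phi> = 1 \<Longrightarrow> norm \<Omega> = 1 \<Longrightarrow> norm (chi_vec \<Phi> \<Omega> x) = 1"
  by (simp add: chi_vec_def)

lemma coin_eq: "coin \<Phi> \<Omega> \<Psi> x = scale_sp (2 * d_chi \<Phi> \<Omega> \<Psi> x) (chi_vec \<Phi> \<Omega> x) - \<Psi> x"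
  by (simp add: coin_def coin_at_def d_chi_def)

text \<open>The shift is -1 on the first summand and +1 on the second, so it maps their sum to their
  difference; both summands lie in the kernel of \<open>d_chi\<close>. Orthogonality of birth
  vectors to \<open>X\<close> and to \<open>S X\<close> rests on this.\<close>

lemma D_birth_d_chi:
  assumes "\<Theta> \<in> D_birth p q \<Phi> \<Omega>"
  shows "\<Theta> \<in> ell2" "d_chi \<Phi> \<Omega> \<Theta> x = 0" "d_chi \<Phi> \<Omega> (shift p q \<Theta>) x = 0"
proof -
  obtain \<Theta>1 \<Theta>2 where \<Theta>: "\<Theta> = (\<lambda>x. \<Theta>1 x + \<Theta>2 x)"
    and in_ell2: "\<Theta>1 \<in> ell2" "\<Theta>2 \<in> ell2"
    and d: "d_chi \<Phi> \<Omega> \<Theta>1 = (\<lambda>x. 0)" "d_chi \<Phi> \<Omega> \<Theta>2 = (\<lambda>x. 0)"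
    and S: "(\<lambda>x. shift p q \<Theta>1 x + \<Theta>1 x) = (\<lambda>x. 0)" "(\<lambda>x. shift p q \<Theta>2 x - \<Theta>2 x) = (\<lambda>x. 0)"
    using assms by (auto simp: D_birth_def D_plus_def D_minus_def)
  show "\<Theta> \<in> ell2" unfolding \<Theta> using in_ell2 by (rule ell2_add)
  show "d_chi \<Phi> \<Omega> \<Theta> x = 0"
    using fun_cong[OF d(1), of x] fun_cong[OF d(2), of x]
    by (simp add: \<Theta> d_chi_def cinner_sp_add_right)
  have "shift p q \<Theta> x = \<Theta>2 x - \<Theta>1 x"
    using shift_linear[of p q 1 \<Theta>1 1 \<Theta>2 x] fun_cong[OF S(1), of x] fun_cong[OF S(2), of x]
    by (simp add: \<Theta> eq_neg_iff_add_eq_0[symmetric])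
  then show "d_chi \<Phi> \<Omega> (shift p q \<Theta>) x = 0"
    using fun_cong[OF d(1), of x] fun_cong[OF d(2), of x]
    by (simp add: d_chi_def cinner_sp_diff_right)
qed

text \<open>Here \<open>C X = X\<close> and \<open>C S X = 2 \<mu> X - S X\<close>, so
  \<open>U\<close> maps \<open>X\<close> to \<open>S X\<close> and \<open>S X\<close> to
  \<open>2 \<mu> S X - X\<close>. The polynomial \<open>z\<^sup>2 - 2 \<mu> z + 1\<close> is the
  characteristic polynomial of this two-by-two action.\<close>

lemma inherited_eigenvalue:
  fixes \<Phi> \<Omega> :: "'d::finite spinor" and f :: "'d lattice \<Rightarrow> complex"
  defines "X \<equiv> \<lambda>x. scale_sp (f x) (chi_vec \<Phi> \<Omega> x)"
  assumes pq: "(p, q) \<in> paramD" and unit: "norm \<Phi> = 1" "norm \<Omega> = 1"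
    and f: "f \<in> ell2" "f x0 \<noteq> 0"
    and eig: "\<And>x. d_chi \<Phi> \<Omega> (shift p q X) x = \<mu> * f x"
  shows "\<mu> \<in> \<real>" "\<bar>Re \<mu>\<bar> \<le> 1"
    and "z\<^sup>2 - 2 * \<mu> * z + 1 = 0 \<Longrightarrow> eigenvalue_on (D_inherited p q \<Phi> \<Omega>) (evolution p q \<Phi> \<Omega>) z"
proof -
  let ?S = "shift p q"
  have Xx: "X x = scale_sp (f x) (chi_vec \<Phi> \<Omega> x)" for x by (simp add: X_def)
  have normX: "norm (X x) = cmod (f x)" for x
    using unit by (simp add: Xx norm_scale_sp norm_chi_vec)
  have X: "X \<in> ell2" using f(1) by (rule ell2_dominated) (simp add: normX)
  then have SX: "?S X \<in> ell2" by (rule ell2_shift)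
  have dX: "d_chi \<Phi> \<Omega> X x = f x" for x
    using unit by (simp add: d_chi_def Xx cinner_sp_scale_right cinner_sp_self norm_chi_vec)
  have left: "cinner_sp (X x) v = cnj (f x) * cinner_sp (chi_vec \<Phi> \<Omega> x) v" for x v
    by (simp add: Xx cinner_sp_scale_left)

  define N where "N = (\<Sum>\<^sub>\<infinity>x. (norm (X x))\<^sup>2)"
  have N: "cinner_ell2 X X = of_real N" unfolding N_def using X by (rule cinner_ell2_self)
  have "N > 0"
  proof (rule ccontr)
    assume "\<not> N > 0"
    then have "(norm (X x0))\<^sup>2 = 0"
      using X by (intro nonneg_infsum_le_0D[of "\<lambda>x. (norm (X x))\<^sup>2" UNIV]) (auto simp: N_def ell2_def)
    then show False using f(2) by (simp add: normX)
  qed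
  have XSX: "cinner_ell2 X (?S X) = \<mu> * N"
  proof -
    have "cinner_sp (X x) (?S X x) = \<mu> * cinner_sp (X x) (X x)" for x
      using eig[of x] dX[of x] by (simp add: left d_chi_def)
    then show ?thesis unfolding N[symmetric] cinner_ell2_def by (simp add: infsum_cmult_right')
  qed
  have SXX: "cinner_ell2 (?S X) X = \<mu> * N" unfolding cinner_ell2_shift[OF X X] XSX ..
  have SXSX: "cinner_ell2 (?S X) (?S X) = N"
    unfolding cinner_ell2_shift[OF X SX] shift_shift[OF pq] N ..
  have "cnj \<mu> * N = \<mu> * N" using cinner_ell2_cnj[of X "?S X"] by (simp add: XSX SXX)
  then have cnj_mu: "cnj \<mu> = \<mu>" using \<open>N > 0\<close> by simp
  then show "\<mu> \<in> \<real>" by (simp add: Reals_cnj_iff)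
  then obtain r where r: "\<mu> = of_real r" by (rule Reals_cases)
  have Y: "(\<lambda>x. X x - scale_sp s (?S X x)) \<in> ell2" for s
  proof -
    have "X x + scale_sp (- s) (?S X x) = X x - scale_sp s (?S X x)" for x
      by (simp add: scale_sp_def vec_eq_iff)
    then show ?thesis using ell2_add[OF X ell2_scale_sp[OF SX, of "- s"]] by simp
  qed
  \<comment> \<open>For \<open>s = 1\<close> and \<open>s = -1\<close> the squared norm of
    \<open>X - s S X\<close> equals \<open>2 (1 - s r) N\<close>; its nonnegativity yields both
    bounds on \<open>r\<close>.\<close>
  have bound: "0 \<le> (1 - s * r) * N" if s: "s * s = 1" for s :: real
  proof -
    define Y where "Y = (\<lambda>x. X x - scale_sp (complex_of_real s) (?S X x))"
    have Y_ell2: "Y \<in> ell2" unfolding Y_def by (rule Y)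
    have "cinner_ell2 X Y = of_real (N - s * (r * N))"
      unfolding Y_def cinner_ell2_diff_right[OF X X SX] N XSX r by simp
    then have 1: "cinner_ell2 Y X = of_real (N - s * (r * N))"
      using cinner_ell2_cnj[of X Y] by simp
    have "cinner_ell2 (?S X) Y = of_real (r * N - s * N)"
      unfolding Y_def cinner_ell2_diff_right[OF SX X SX] SXX SXSX r by simp
    then have 2: "cinner_ell2 Y (?S X) = of_real (r * N - s * N)"
      using cinner_ell2_cnj[of "?S X" Y] by simp
    have "cinner_ell2 Y Y = of_real (N - s * (r * N)) - of_real s * of_real (r * N - s * N)"
      using cinner_ell2_diff_right[OF Y_ell2 X SX, of s] unfolding Y_def[symmetric] 1 2 .
    also have "\<dots> = of_real ((N - s * (r * N)) - s * (r * N - s * N))" by simp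
    also have "(N - s * (r * N)) - s * (r * N - s * N) = N + (s * s) * N - 2 * (s * r * N)"
      by (simp add: algebra_simps)
    also have "\<dots> = 2 * ((1 - s * r) * N)" unfolding s by (simp add: algebra_simps)
    finally have "2 * ((1 - s * r) * N) = (\<Sum>\<^sub>\<infinity>x. (norm (Y x))\<^sup>2)"
      unfolding cinner_ell2_self[OF Y_ell2] of_real_eq_iff by simp
    then show ?thesis using infsum_nonneg[of UNIV "\<lambda>x. (norm (Y x))\<^sup>2"] by simp
  qed
  have "1 - r \<ge> 0" "1 + r \<ge> 0"
    using bound[of 1] bound[of "- 1"] \<open>N > 0\<close> by (simp_all add: zero_le_mult_iff)
  then show "\<bar>Re \<mu>\<bar> \<le> 1" by (simp add: r)

  assume z: "z\<^sup>2 - 2 * \<mu> * z + 1 = 0"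
  \<comment> \<open>Pairing with \<open>X\<close> only sees \<open>d_chi\<close> of the other
    vector; for \<open>S X\<close> the shift is first moved onto \<open>\<Theta>\<close> by
    symmetry.\<close>
  have orth: "cinner_ell2 \<Theta> X = 0" "cinner_ell2 \<Theta> (?S X) = 0" if "\<Theta> \<in> D_birth p q \<Phi> \<Omega>" for \<Theta>
  proof -
    have zero: "cinner_ell2 \<Xi> X = 0" if "\<And>x. d_chi \<Phi> \<Omega> \<Xi> x = 0" for \<Xi>
    proof -
      have "cinner_sp (\<Xi> x) (X x) = 0" for x
        using that[of x] left[of x "\<Xi> x"] cinner_sp_commute[of "X x" "\<Xi> x"] by (simp add: d_chi_def)
      then show ?thesis by (simp add: cinner_ell2_def)
    qed
    show "cinner_ell2 \<Theta> X = 0" by (rule zero) (rule D_birth_d_chi[OF that])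
    have "cinner_ell2 (?S \<Theta>) X = 0" by (rule zero) (rule D_birth_d_chi[OF that])
    then show "cinner_ell2 \<Theta> (?S X) = 0"
      using cinner_ell2_shift[OF D_birth_d_chi(1)[OF that] X] by simp
  qed
  show "eigenvalue_on (D_inherited p q \<Phi> \<Omega>) (evolution p q \<Phi> \<Omega>) z"
  proof (cases "\<forall>x. X x = scale_sp z (?S X x)")
    case True
    \<comment> \<open>the candidate \<open>X - z S X\<close> degenerates; this forces \<open>z = \<mu> = \<plusminus>1\<close>, and \<open>X\<close> itself is an eigenvector\<close>
    have "f x0 = z * \<mu> * f x0"
    proof -
      have "cinner_sp (chi_vec \<Phi> \<Omega> x0) (X x0) = cinner_sp (chi_vec \<Phi> \<Omega> x0) (scale_sp z (?S X x0))"
        by (rule arg_cong[OF True[rule_format]])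
      then show ?thesis using dX[of x0] eig[of x0] by (simp add: d_chi_def cinner_sp_scale_right)
    qed
    then have "z * \<mu> = 1" using f(2) by simp
    moreover have "z * z = 2 * (z * \<mu>) - 1" using z by (simp add: power2_eq_square algebra_simps)
    ultimately have "z * z = 1" by simp
    then have "scale_sp z (X x) = ?S X x" for x
    proof -
      have "scale_sp z (X x) = scale_sp z (scale_sp z (?S X x))" by (rule arg_cong[OF True[rule_format]])
      then show ?thesis by (simp only: scale_sp_scale_sp \<open>z * z = 1\<close> scale_sp_1)
    qed
    moreover have "coin \<Phi> \<Omega> X = X"
      by (rule ext, unfold coin_eq dX) (simp add: Xx scale_sp_def vec_eq_iff)
    moreover have "X \<in> D_inherited p q \<Phi> \<Omega>"
      using X orth by (simp add: D_inherited_def orth_compl_def)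
    moreover have "X \<noteq> (\<lambda>x. 0)" using normX[of x0] f(2) by auto
    ultimately show ?thesis unfolding eigenvalue_on_def evolution_def by (intro bexI[of _ X]) auto
  next
    case False
    define Y where "Y = (\<lambda>x. X x - scale_sp z (?S X x))"
    have "Y \<in> D_inherited p q \<Phi> \<Omega>"
      using Y orth by (simp add: D_inherited_def orth_compl_def Y_def cinner_ell2_diff_right X SX D_birth_d_chi(1))
    moreover have "Y \<noteq> (\<lambda>x. 0)"
      using False by (auto simp: Y_def fun_eq_iff)
    moreover have "evolution p q \<Phi> \<Omega> Y = (\<lambda>x. scale_sp z (Y x))"
    proof -
      have dY: "d_chi \<Phi> \<Omega> Y x = (1 - z * \<mu>) * f x" for x
        using dX[of x] eig[of x]
        by (simp add: Y_def d_chi_def cinner_sp_diff_right cinner_sp_scale_right algebra_simps)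
      have Yx: "Y x = X x - scale_sp z (?S X x)" for x by (simp add: Y_def)
      \<comment> \<open>By the quadratic equation the coefficient \<open>1 - 2 \<mu> z\<close> is
        \<open>- z\<^sup>2\<close>. Applying the involution \<open>S\<close> to
        \<open>- z\<^sup>2 X + z S X\<close> then gives \<open>z (X - z S X)\<close>.\<close>
      have "coin \<Phi> \<Omega> Y x = scale_sp (1 - 2 * \<mu> * z) (X x) + scale_sp z (?S X x)" for x
        unfolding coin_eq dY Yx by (simp add: Xx vec_eq_iff scale_sp_def algebra_simps del: shift_nth)
      moreover have "1 - 2 * \<mu> * z = - (z * z)"
        using z by (simp add: power2_eq_square algebra_simps eq_neg_iff_add_eq_0)
      ultimately have "coin \<Phi> \<Omega> Y = (\<lambda>x. scale_sp (- (z * z)) (X x) + scale_sp z (?S X x))"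
        by auto
      then show ?thesis
        unfolding evolution_def
        by (intro ext) (simp add: shift_linear shift_shift[OF pq] Yx del: shift_nth,
          simp add: scale_sp_def vec_eq_iff algebra_simps del: shift_nth)
    qed
    ultimately show ?thesis unfolding eigenvalue_on_def by blast
  qed
qed

text \<open>For such \<open>t\<close> the two numbers are
  \<open>t \<plusminus> \<i> sqrt (1 - t\<^sup>2)\<close>, the roots of the quadratic.\<close>

lemma g_plus_minus_quadratic:
  assumes "\<bar>t\<bar> \<le> 1"
  shows "(g_plus t)\<^sup>2 - 2 * of_real t * g_plus t + 1 = 0"
    and "(g_minus t)\<^sup>2 - 2 * of_real t * g_minus t + 1 = 0"
proof -
  have s: "(sqrt (1 - t\<^sup>2))\<^sup>2 = 1 - t\<^sup>2" using assms by (simp add: abs_square_le_1)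
  have "g_plus t = cis (arccos t)" "g_minus t = cis (- arccos t)"
    by (simp_all add: g_plus_def g_minus_def cis_conv_exp)
  then have g: "g_plus t = Complex t (sqrt (1 - t\<^sup>2))" "g_minus t = Complex t (- sqrt (1 - t\<^sup>2))"
    using assms by (simp_all add: complex_eq_iff cos_arccos_abs sin_arccos_abs)
  show "(g_plus t)\<^sup>2 - 2 * of_real t * g_plus t + 1 = 0"
    and "(g_minus t)\<^sup>2 - 2 * of_real t * g_minus t + 1 = 0"
    using s by (simp_all add: g complex_eq_iff power2_eq_square)
qed


section \<open>An eigenfunction of the discriminant\<close>

text \<open>The off-diagonal part of the discriminant. Evaluating \<open>chi_vec\<close> at both
  ends of each bond incorporates the defect at the origin.\<close>

definition hopping ::
  "complex ^ 'd::finite \<Rightarrow> 'd spinor \<Rightarrow> 'd spinor \<Rightarrow> ('d lattice \<Rightarrow> complex) \<Rightarrow> 'd lattice \<Rightarrow> complex" where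
  "hopping q \<Phi> \<Omega> f x = (\<Sum>j\<in>UNIV.
     q $ j * cnj (chi_vec \<Phi> \<Omega> x $ j $ 1) * chi_vec \<Phi> \<Omega> (x + axis j 1) $ j $ 2 * f (x + axis j 1)
     + cnj (q $ j) * cnj (chi_vec \<Phi> \<Omega> x $ j $ 2) * chi_vec \<Phi> \<Omega> (x - axis j 1) $ j $ 1 * f (x - axis j 1))"

lemma Re_cinner2_sigma3: "Re (cinner2 v (sigma3 *v v)) = (cmod (v $ 1))\<^sup>2 - (cmod (v $ 2))\<^sup>2"
  by (simp add: cinner2_def sigma3_def matrix_vector_mult_def sum_2 cmod_power2)
     (simp add: power2_eq_square)

text \<open>The \<open>p\<close>-terms of the shift act on site and assemble to
  \<open>a_coef\<close>, because \<open>\<sigma>\<^sub>3\<close> gives the difference of the squared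
  moduli of the two entries; the \<open>q\<close>-terms connect neighbours.\<close>

lemma d_chi_shift:
  "d_chi \<Phi> \<Omega> (shift p q (\<lambda>x. scale_sp (f x) (chi_vec \<Phi> \<Omega> x))) x
     = of_real (a_coef (chi_vec \<Phi> \<Omega> x) p) * f x + hopping q \<Phi> \<Omega> f x"
proof -
  have sq: "complex_of_real ((cmod w)\<^sup>2) = cnj w * w" for w
    by (simp add: complex_norm_square mult.commute[of "cnj w"] del: of_real_power)
  show ?thesis
    unfolding d_chi_def cinner_sp_def hopping_def a_coef_def Re_cinner2_sigma3 of_real_sum
      sum_distrib_right sum.distrib[symmetric] of_real_mult of_real_diff sq
    by (intro sum.cong refl) (simp add: cinner2_def sum_2 scale_sp_def algebra_simps)
qed

lemma hopping_diff:
  "hopping q \<Phi> \<Omega> (\<lambda>y. f y - g y) x = hopping q \<Phi> \<Omega> f x - hopping q \<Phi> \<Omega> g x"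
  unfolding hopping_def sum_subtractf[symmetric] by (intro sum.cong refl) (simp add: algebra_simps)

text \<open>The factor 4 comes from two neighbours in each direction and a loss of 2 in the weight
  at each; entries of unit vectors have modulus at most 1.\<close>

lemma hopping_bound:
  assumes unit: "norm \<Phi> = 1" "norm \<Omega> = 1" and f: "\<And>y. cmod (f y) \<le> M * l1_weight y"
  shows "cmod (hopping q \<Phi> \<Omega> f x) \<le> 4 * (\<Sum>j\<in>UNIV. cmod (q $ j)) * M * l1_weight x"
proof -
  have M: "M \<ge> 0"
    using order_trans[OF norm_ge_zero f[of x]] l1_weight_pos[of x] by (simp add: zero_le_mult_iff)
  have chi: "cmod (chi_vec \<Phi> \<Omega> y $ j $ i) \<le> 1" for y j i
    using cmod_entry_le_norm[of "chi_vec \<Phi> \<Omega> y" j i] norm_chi_vec[OF unit] by simp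
  have term_le: "cmod (a * cnj (chi_vec \<Phi> \<Omega> x $ j $ i) * chi_vec \<Phi> \<Omega> (x + axis j s) $ j $ k * f (x + axis j s))
      \<le> cmod a * (2 * M * l1_weight x)" if "\<bar>s\<bar> = 1" for a j i k s
  proof -
    have "cmod (f (x + axis j s)) \<le> M * (2 * l1_weight x)"
      using f order_trans mult_left_mono[OF l1_weight_neighbour[OF that] M] by blast
    then have "cmod a * 1 * 1 * cmod (f (x + axis j s)) \<le> cmod a * (2 * M * l1_weight x)"
      using mult_left_mono[of "cmod (f (x + axis j s))" "2 * M * l1_weight x" "cmod a"] by (simp add: mult_ac)
    moreover have "cmod a * cmod (chi_vec \<Phi> \<Omega> x $ j $ i) * cmod (chi_vec \<Phi> \<Omega> (x + axis j s) $ j $ k)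
        * cmod (f (x + axis j s)) \<le> cmod a * 1 * 1 * cmod (f (x + axis j s))"
      using chi by (intro mult_mono) auto
    ultimately show ?thesis by (simp add: norm_mult)
  qed
  have minus: "x - axis j 1 = x + axis j (- 1)" for j
    by (simp add: vec_eq_iff axis_def)
  have "cmod (hopping q \<Phi> \<Omega> f x) \<le> (\<Sum>j\<in>UNIV. cmod (q $ j) * (2 * M * l1_weight x)
      + cmod (cnj (q $ j)) * (2 * M * l1_weight x))"
    unfolding hopping_def minus
    by (intro sum_norm_le order_trans[OF norm_triangle_ineq] add_mono term_le) auto
  also have "\<dots> = 4 * (\<Sum>j\<in>UNIV. cmod (q $ j)) * M * l1_weight x"
    by (simp add: sum_distrib_left sum_distrib_right algebra_simps flip: sum.distrib)
  finally show ?thesis .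
qed

text \<open>\<open>a_coef V\<close> is linear in \<open>p\<close>, with coefficients in
  \<open>[-1, 1]\<close> for a unit vector \<open>V\<close>.\<close>

lemma a_coef_diff_le:
  fixes V :: "'d::finite spinor"
  assumes "norm V = 1"
  shows "\<bar>a_coef V p - a_coef V p'\<bar> \<le> CARD('d) * norm (p - p')"
proof -
  have s: "\<bar>Re (cinner2 (V $ j) (sigma3 *v (V $ j)))\<bar> \<le> 1" for j
  proof -
    have "(cmod (V $ j $ i))\<^sup>2 \<le> 1" for i
      using cmod_entry_le_norm[of V j i] assms by (simp add: power_le_one)
    from this[of 1] this[of 2] show ?thesis unfolding Re_cinner2_sigma3
      by (smt (verit) zero_le_power2)
  qed
  have "\<bar>a_coef V p - a_coef V p'\<bar> = \<bar>\<Sum>j\<in>UNIV. (p - p') $ j * Re (cinner2 (V $ j) (sigma3 *v (V $ j)))\<bar>"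
    by (simp add: a_coef_def algebra_simps flip: sum_subtractf)
  also have "\<dots> \<le> (\<Sum>j\<in>(UNIV::'d set). norm (p - p'))"
  proof (intro order_trans[OF sum_abs] sum_mono)
    fix j
    have "\<bar>(p - p') $ j * Re (cinner2 (V $ j) (sigma3 *v (V $ j)))\<bar> \<le> norm (p - p') * 1"
      unfolding abs_mult using s Finite_Cartesian_Product.norm_nth_le[of "p - p'" j]
      by (intro mult_mono) auto
    then show "\<bar>(p - p') $ j * Re (cinner2 (V $ j) (sigma3 *v (V $ j)))\<bar> \<le> norm (p - p')" by simp
  qed
  finally show ?thesis by simp
qed

lemma lambda_coef_le:
  assumes "norm \<Phi> = 1"
  shows "lambda_coef \<Phi> q \<le> 2 * (\<Sum>j\<in>UNIV. cmod (q $ j))"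
proof -
  have "cmod (cinner2 (\<Phi> $ j) (sigma_plus *v (\<Phi> $ j))) \<le> 1" for j
    using cmod_entry_le_norm[of \<Phi> j 1] cmod_entry_le_norm[of \<Phi> j 2] assms
    by (simp add: cinner2_def sigma_plus_def matrix_vector_mult_def sum_2 norm_mult mult_le_one)
  then have "cmod (q $ j * cinner2 (\<Phi> $ j) (sigma_plus *v (\<Phi> $ j))) \<le> cmod (q $ j)" for j
    by (simp add: norm_mult mult_left_le)
  then show ?thesis unfolding lambda_coef_def by (intro mult_left_mono sum_mono) auto
qed

text \<open>Domination by \<open>l1_weight\<close> puts \<open>f\<close> into \<open>ell2\<close>,
  and the only correction to \<open>a_coef \<Omega> p\<close> in the eigenvalue is the hopping term
  at the origin.\<close>

lemma discriminant_eigenfunction: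
  fixes \<Phi> \<Omega> :: "'d::finite spinor"
  assumes unit: "norm \<Phi> = 1" "norm \<Omega> = 1"
    and gap: "a_coef \<Omega> p \<noteq> a_coef \<Phi> p"
      "32 * (\<Sum>j\<in>UNIV. cmod (q $ j)) \<le> \<bar>a_coef \<Omega> p - a_coef \<Phi> p\<bar>"
  obtains f \<mu> where "f \<in> ell2" "f 0 = 1"
    "\<And>x. d_chi \<Phi> \<Omega> (shift p q (\<lambda>x. scale_sp (f x) (chi_vec \<Phi> \<Omega> x))) x = \<mu> * f x"
    "cmod (\<mu> - a_coef \<Omega> p) \<le> 4 * (\<Sum>j\<in>UNIV. cmod (q $ j))"
proof -
  define c where "c = complex_of_real (a_coef \<Omega> p - a_coef \<Phi> p)"
  have "\<exists>f. f 0 = 1 \<and> (\<forall>x. cmod (f x) \<le> l1_weight x)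
      \<and> (\<forall>x. x \<noteq> 0 \<longrightarrow> (c + hopping q \<Phi> \<Omega> f 0) * f x = hopping q \<Phi> \<Omega> f x)"
  \<comment> \<open>With \<open>\<eta>\<close> four times the sum of the \<open>|q\<^sub>j|\<close>,
    the requirement \<open>8 * \<eta> \<le> cmod c\<close> is the assumed gap with constant
    32.\<close>
  proof (rule decaying_solution[of l1_weight 0 "hopping q \<Phi> \<Omega>" "4 * (\<Sum>j\<in>UNIV. cmod (q $ j))" c], goal_cases)
    case (4 f M x)
    then show ?case by (rule hopping_bound[OF unit])
  next
    case 5
    show ?case unfolding c_def norm_of_real using gap by simp
  next
    case 6
    show ?case using gap by (simp add: c_def)
  next
    case 7
    show ?case by (simp add: sum_nonneg)
  next
    case (8 f)
    then show ?case by (intro exI[of _ f] conjI allI impI)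
  qed (rule l1_weight_pos l1_weight_0 hopping_diff)+
  then obtain f where f': "f 0 = 1 \<and> (\<forall>x. cmod (f x) \<le> l1_weight x)
      \<and> (\<forall>x. x \<noteq> 0 \<longrightarrow> (c + hopping q \<Phi> \<Omega> f 0) * f x = hopping q \<Phi> \<Omega> f x)"
    by (rule exE)
  note f = conjunct1[OF f'] conjunct1[OF conjunct2[OF f'], rule_format]
    conjunct2[OF conjunct2[OF f'], rule_format]
  show thesis
  proof (rule that[of f "a_coef \<Omega> p + hopping q \<Phi> \<Omega> f 0"])
    show "f \<in> ell2"
    proof -
      have "(cmod (f x))\<^sup>2 \<le> (l1_weight x)\<^sup>2" for x by (rule power_mono[OF f(2) norm_ge_zero])
      from summable_on_comparison_test[OF l1_weight_sq_summable this zero_le_power2]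
      show ?thesis by (simp add: ell2_def)
    qed
    \<comment> \<open>At the origin the equation is the choice of the eigenvalue, as
      \<open>f 0 = 1\<close>; elsewhere it is the equation solved by \<open>f\<close>.\<close>
    show "d_chi \<Phi> \<Omega> (shift p q (\<lambda>x. scale_sp (f x) (chi_vec \<Phi> \<Omega> x))) x
        = (a_coef \<Omega> p + hopping q \<Phi> \<Omega> f 0) * f x" for x
    proof (cases "x = 0")
      case False
      then have "d_chi \<Phi> \<Omega> (shift p q (\<lambda>x. scale_sp (f x) (chi_vec \<Phi> \<Omega> x))) x
          = a_coef \<Phi> p * f x + (c + hopping q \<Phi> \<Omega> f 0) * f x"
        unfolding d_chi_shift f(3)[OF False] by (simp add: chi_vec_def)
      then show ?thesis by (simp add: c_def algebra_simps)
    next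
      case True
      show ?thesis unfolding True d_chi_shift f(1) by (simp add: chi_vec_def)
    qed
    show "cmod (a_coef \<Omega> p + hopping q \<Phi> \<Omega> f 0 - a_coef \<Omega> p) \<le> 4 * (\<Sum>j\<in>UNIV. cmod (q $ j))"
      using hopping_bound[OF unit, of f 1 q 0] f(2) by simp
  qed (rule f)
qed

theorem theorem3p7:
  fixes \<Phi> \<Omega> :: "complex ^ 2 ^ 'd::finite"
    and l :: 'd
    and p0 :: "real ^ 'd"
  assumes "CARD('d) \<ge> 2"
    and "norm \<Phi> = 1" and "norm \<Omega> = 1"
    and "\<And>j. bdot2 (\<Phi> $ j) (sigma1 *v (\<Omega> $ j)) = 0"
    and "cinner2 (\<Phi> $ l) (sigma_plus *v (\<Omega> $ l)) \<noteq> 0"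
    and "\<And>j. p0 $ j \<in> {-1, 1}"
    and "a_coef \<Omega> p0 \<noteq> a_coef \<Phi> p0"
  shows "\<exists>\<delta>>0. \<forall>(p, q) \<in> paramDl l. norm ((p, q) - (p0, 0)) < \<delta> \<longrightarrow>
     (\<exists>z. eigenvalue_on ell2 (evolution p q \<Phi> \<Omega>) z) \<and>
     (a_coef \<Omega> p0 < a_coef \<Phi> p0 \<longrightarrow>
        (\<exists>t \<in> T_minus \<Phi> p q.
           eigenvalue_on (D_inherited p q \<Phi> \<Omega>) (evolution p q \<Phi> \<Omega>) (g_minus t) \<and>
           eigenvalue_on (D_inherited p q \<Phi> \<Omega>) (evolution p q \<Phi> \<Omega>) (g_plus t))) \<and>
     (a_coef \<Omega> p0 > a_coef \<Phi> p0 \<longrightarrow>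
        (\<exists>t \<in> T_plus \<Phi> p q.
           eigenvalue_on (D_inherited p q \<Phi> \<Omega>) (evolution p q \<Phi> \<Omega>) (g_minus t) \<and>
           eigenvalue_on (D_inherited p q \<Phi> \<Omega>) (evolution p q \<Phi> \<Omega>) (g_plus t)))"
proof -
  note unit = assms(2,3)
  define \<gamma> where "\<gamma> = \<bar>a_coef \<Omega> p0 - a_coef \<Phi> p0\<bar>"
  have \<gamma>: "\<gamma> > 0" using assms(7) by (simp add: \<gamma>_def)
  \<comment> \<open>This radius keeps the change of each \<open>a_coef\<close> and the sum of the
    \<open>|q\<^sub>j|\<close> within \<open>\<gamma> / 64\<close>. Consequently
    \<open>lambda_coef\<close> is at most \<open>\<gamma> / 32\<close> and the eigenvalue lies
    within \<open>\<gamma> / 16\<close> of \<open>a_coef \<Omega> p\<close>.\<close>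
  define \<delta> where "\<delta> = \<gamma> / (64 * CARD('d))"
  have \<delta>: "\<delta> > 0" "CARD('d) * \<delta> = \<gamma> / 64" using \<gamma> by (simp_all add: \<delta>_def)
  \<comment> \<open>One \<open>t\<close> serves both cases; the sign of the gap only decides on
    which side of the interval around \<open>a_coef \<Phi> p\<close> it falls, and
    \<open>\<bar>t\<bar> \<le> 1\<close> supplies the outer endpoint.\<close>
  have main: "\<exists>t. \<bar>t\<bar> \<le> 1
      \<and> (a_coef \<Omega> p0 < a_coef \<Phi> p0 \<longrightarrow> t < - lambda_coef \<Phi> q + a_coef \<Phi> p)
      \<and> (a_coef \<Omega> p0 > a_coef \<Phi> p0 \<longrightarrow> t > lambda_coef \<Phi> q + a_coef \<Phi> p)
      \<and> eigenvalue_on (D_inherited p q \<Phi> \<Omega>) (evolution p q \<Phi> \<Omega>) (g_minus t)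
      \<and> eigenvalue_on (D_inherited p q \<Phi> \<Omega>) (evolution p q \<Phi> \<Omega>) (g_plus t)"
    if pq: "(p, q) \<in> paramDl l" and near: "norm ((p, q) - (p0, 0)) < \<delta>" for p q
  proof -
    define s where "s = (\<Sum>j\<in>UNIV. cmod (q $ j))"
    have "norm (p - p0) < \<delta>" "norm q < \<delta>"
      using near norm_fst_le[of "p - p0" q] norm_snd_le[of q "p - p0"] by auto
    then have "CARD('d) * norm (p - p0) \<le> \<gamma> / 64"
      unfolding \<delta>(2)[symmetric] by (intro mult_left_mono) auto
    then have a: "\<bar>a_coef V p - a_coef V p0\<bar> \<le> \<gamma> / 64" if "norm V = 1" for V :: "'d spinor"
      using a_coef_diff_le[OF that, of p p0] by linarith
    have "s \<le> (\<Sum>j\<in>(UNIV::'d set). \<delta>)"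
      unfolding s_def using \<open>norm q < \<delta>\<close> Finite_Cartesian_Product.norm_nth_le[of q]
      by (intro sum_mono) (meson less_imp_le order_trans)
    then have s: "s \<le> \<gamma> / 64" using \<delta>(2) by simp
    have lam: "lambda_coef \<Phi> q \<le> \<gamma> / 32" using lambda_coef_le[OF unit(1), of q] s by (simp add: s_def)
    have gap': "\<bar>a_coef \<Omega> p - a_coef \<Phi> p\<bar> \<ge> \<gamma> - \<gamma> / 32"
      using a[OF unit(1)] a[OF unit(2)] unfolding \<gamma>_def by linarith
    then have gap: "a_coef \<Omega> p \<noteq> a_coef \<Phi> p" "32 * s \<le> \<bar>a_coef \<Omega> p - a_coef \<Phi> p\<bar>"
      using s \<gamma> by auto
    obtain f \<mu> where f: "f \<in> ell2" "f 0 = 1"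
      and eig: "\<And>x. d_chi \<Phi> \<Omega> (shift p q (\<lambda>x. scale_sp (f x) (chi_vec \<Phi> \<Omega> x))) x = \<mu> * f x"
      and mu: "cmod (\<mu> - a_coef \<Omega> p) \<le> 4 * s"
      by (rule discriminant_eigenfunction[OF unit gap[unfolded s_def], folded s_def]) blast
    have "(p, q) \<in> paramD" "f 0 \<noteq> 0" using pq f(2) by (simp_all add: paramDl_def)
    note inh = inherited_eigenvalue[OF this(1) unit f(1) this(2) eig]
    define t where "t = Re \<mu>"
    have t: "\<mu> = of_real t" "\<bar>t\<bar> \<le> 1" using inh(1,2) by (simp_all add: t_def)
    have near_t: "\<bar>t - a_coef \<Omega> p\<bar> \<le> \<gamma> / 16"
      using mu s unfolding t(1) of_real_diff[symmetric] norm_of_real by simp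
    \<comment> \<open>The gap at \<open>p\<close> is at least \<open>31 \<gamma> / 32\<close>, while
      the errors from \<open>t\<close> and \<open>lambda_coef\<close> together are at most
      \<open>3 \<gamma> / 32\<close>.\<close>
    have below: "t < - lambda_coef \<Phi> q + a_coef \<Phi> p" if "a_coef \<Omega> p0 < a_coef \<Phi> p0"
    proof -
      have "\<gamma> = a_coef \<Phi> p0 - a_coef \<Omega> p0" using that by (simp add: \<gamma>_def)
      then show ?thesis using a[OF unit(1)] a[OF unit(2)] lam \<gamma> near_t by linarith
    qed
    have above: "t > lambda_coef \<Phi> q + a_coef \<Phi> p" if "a_coef \<Omega> p0 > a_coef \<Phi> p0"
    proof -
      have "\<gamma> = a_coef \<Omega> p0 - a_coef \<Phi> p0" using that by (simp add: \<gamma>_def)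
      then show ?thesis using a[OF unit(1)] a[OF unit(2)] lam \<gamma> near_t by linarith
    qed
    have "eigenvalue_on (D_inherited p q \<Phi> \<Omega>) (evolution p q \<Phi> \<Omega>) (g_minus t)"
      by (rule inh(3), unfold t(1), rule g_plus_minus_quadratic(2)[OF t(2)])
    moreover have "eigenvalue_on (D_inherited p q \<Phi> \<Omega>) (evolution p q \<Phi> \<Omega>) (g_plus t)"
      by (rule inh(3), unfold t(1), rule g_plus_minus_quadratic(1)[OF t(2)])
    ultimately show ?thesis using t(2) below above by auto
  qed
  \<comment> \<open>The inherited subspace lies in \<open>ell2\<close>, so its eigenvectors are
    eigenvectors of the whole evolution.\<close>
  have ell2: "eigenvalue_on ell2 U z" if "eigenvalue_on (D_inherited p q \<Phi> \<Omega>) U z" for p q U z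
    using that by (auto simp: eigenvalue_on_def D_inherited_def orth_compl_def)
  show ?thesis
  proof (intro exI[of _ \<delta>] conjI \<delta>(1) ballI, clarify)
    fix p q
    assume "(p, q) \<in> paramDl l" "norm ((p, q) - (p0, 0)) < \<delta>"
    from main[OF this] obtain t where t: "\<bar>t\<bar> \<le> 1"
      "a_coef \<Omega> p0 < a_coef \<Phi> p0 \<Longrightarrow> t \<in> T_minus \<Phi> p q"
      "a_coef \<Omega> p0 > a_coef \<Phi> p0 \<Longrightarrow> t \<in> T_plus \<Phi> p q"
      and ev: "eigenvalue_on (D_inherited p q \<Phi> \<Omega>) (evolution p q \<Phi> \<Omega>) (g_minus t)"
      "eigenvalue_on (D_inherited p q \<Phi> \<Omega>) (evolution p q \<Phi> \<Omega>) (g_plus t)"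
      unfolding T_minus_def T_plus_def by (auto simp: abs_le_iff)
    show "(\<exists>z. eigenvalue_on ell2 (evolution p q \<Phi> \<Omega>) z) \<and>
     (a_coef \<Omega> p0 < a_coef \<Phi> p0 \<longrightarrow>
        (\<exists>t \<in> T_minus \<Phi> p q.
           eigenvalue_on (D_inherited p q \<Phi> \<Omega>) (evolution p q \<Phi> \<Omega>) (g_minus t) \<and>
           eigenvalue_on (D_inherited p q \<Phi> \<Omega>) (evolution p q \<Phi> \<Omega>) (g_plus t))) \<and>
     (a_coef \<Omega> p0 > a_coef \<Phi> p0 \<longrightarrow>
        (\<exists>t \<in> T_plus \<Phi> p q.
           eigenvalue_on (D_inherited p q \<Phi> \<Omega>) (evolution p q \<Phi> \<Omega>) (g_minus t) \<and>
           eigenvalue_on (D_inherited p q \<Phi> \<Omega>) (evolution p q \<Phi> \<Omega>) (g_plus t)))"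
      by (intro conjI impI exI[of _ "g_minus t"] bexI[of _ t] ell2[OF ev(1)] ev t(2,3))
  qed
qed

end
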